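(* In the bifurcating autoregressive (BAR) model, assume that the distribution $\nu$ of the ancestor $X_1$ has finite moments of all orders. Let $H_0=\{(\alpha_0,\beta_0)=(\alpha_1,\beta_1)\}$ and $H_1=\{(\alpha_0,\beta_0)\ne(\alpha_1,\beta_1)\}$. Then the test statistic $$\chi_r^{(1)}=\frac{|\mathbb T_r|}{2\hat\sigma_r^2(1-\hat\rho_r)}\Big\{(\hat\alpha_0^r-\hat\alpha_1^r)^2(\hat\mu_{2,r}-\hat\mu_{1,r}^2)+\big((\hat\alpha_0^r-\hat\alpha_1^r)\hat\mu_{1,r}+\hat\beta_0^r-\hat\beta_1^r\big)^2\Big\}$$ converges in distribution, as $r\to\infty$, to $\chi^2(2)$, the $\chi^2$ distribution with two degrees of freedom, under $H_0$, and almost surely diverges to $+\infty$ under $H_1$.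
   Context: Tree. $\mathbb T=\mathbb N^*=\{1,2,\dots\}$ is the binary tree (vertex $n$ has daughters $2n$, $2n+1$); $\mathbb T_r=\{1,\dots,2^{r+1}-1\}$ is the set of the first $r+1$ generations. BAR model. $X_1$ has distribution $\nu$ on $\mathbb R$ and for all $n\ge1$, $$X_{2n}=\alpha_0X_n+\beta_0+\varepsilon_{2n},\qquad X_{2n+1}=\alpha_1X_n+\beta_1+\varepsilon_{2n+1},$$ where $\alpha_0,\alpha_1\in(-1,1)$, $\beta_0,\beta_1\in\mathbb R$, and $((\varepsilon_{2n},\varepsilon_{2n+1}),n\ge1)$ is a sequence, independent of $X_1$, of i.i.d. centered bivariate Gaussian vectors with covariance matrix $\sigma^2\begin{pmatrix}1&\rho\\\rho&1\end{pmatrix}$, $\sigma^2>0$, $\rho\in(-1,1)$. Write $\theta=(\alpha_0,\beta_0,\alpha_1,\beta_1)$. Moment functions. With $\bar\alpha=(\alpha_0+\alpha_1)/2$, $\bar\beta=(\beta_0+\beta_1)/2$, $\overline{\alpha\beta}=(\alpha_0\beta_0+\alpha_1\beta_1)/2$, $\overline{\alpha^2}=(\alpha_0^2+\alpha_1^2)/2$, $\overline{\beta^2}=(\beta_0^2+\beta_1^2)/2$, put $$\mu_1(\theta)=\frac{\bar\beta}{1-\bar\alpha},\qquad\mu_2(\theta,\sigma^2)=\frac{2\overline{\alpha\beta}\,\bar\beta/(1-\bar\alpha)+\overline{\beta^2}+\sigma^2}{1-\overline{\alpha^2}}.$$ Estimators. For $\varepsilon\in\{0,1\}$, $$\hat\alpha_\varepsilon^r=\frac{|\mathbb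 T_r|^{-1}\sum_{i\in\mathbb T_r}X_iX_{2i+\varepsilon}-\big(|\mathbb T_r|^{-1}\sum_{i\in\mathbb T_r}X_i\big)\big(|\mathbb T_r|^{-1}\sum_{i\in\mathbb T_r}X_{2i+\varepsilon}\big)}{|\mathbb T_r|^{-1}\sum_{i\in\mathbb T_r}X_i^2-\big(|\mathbb T_r|^{-1}\sum_{i\in\mathbb T_r}X_i\big)^2},$$ $$\hat\beta_\varepsilon^r=|\mathbb T_r|^{-1}\sum_{i\in\mathbb T_r}X_{2i+\varepsilon}-\hat\alpha_\varepsilon^r|\mathbb T_r|^{-1}\sum_{i\in\mathbb T_r}X_i,$$ $\hat\theta^r=(\hat\alpha_0^r,\hat\beta_0^r,\hat\alpha_1^r,\hat\beta_1^r)$. The residues are $\hat\varepsilon_{2n}=X_{2n}-\hat\alpha_0^rX_n-\hat\beta_0^r$, $\hat\varepsilon_{2n+1}=X_{2n+1}-\hat\alpha_1^rX_n-\hat\beta_1^r$ ($n\in\mathbb T_r$), and $$\hat\sigma_r^2=\frac1{2|\mathbb T_r|}\sum_{i\in\mathbb T_r}(\hat\varepsilon_{2i}^2+\hat\varepsilon_{2i+1}^2),\qquad\hat\rho_r=\frac1{\hat\sigma_r^2|\mathbb T_r|}\sum_{i\in\mathbb T_r}\hat\varepsilon_{2i}\hat\varepsilon_{2i+1}.$$ Finally $\hat\mu_{1,r}=\mu_1(\hat\theta^r)$ and $\hat\mu_{2,r}=\mu_2(\hat\theta^r,\hat\sigma_r^2)$. (Quotients are given arbitrary values where a denominator vanishes.)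 *)

theory Defs
  imports "HOL-Probability.Probability"
begin

section \<open>Probability distributions\<close>

text \<open>The law of the sum of the squares of \<open>k\<close> independent standard normal variables.\<close>

definition chi_square :: "nat \<Rightarrow> real measure" where
  "chi_square k =
     distr (PiM {..<k} (\<lambda>_. density lborel std_normal_density)) borel (\<lambda>z. \<Sum>i<k. (z i)\<^sup>2)"

text \<open>Centered Gaussian vectors \<open>(V, W)\<close> with a positive definite covariance matrix
  \<open>(s11, s12; s12, s22)\<close>: every linear combination with coefficients \<open>(u, v) \<noteq> (0, 0)\<close> is a
  centered normal variable, whose variance is the value of the covariance form at \<open>(u, v)\<close>.
  (\<^const>\<open>normal_density\<close> takes the standard deviation as its parameter.)\<close>

definition centered_gaussian_pair ::
  "'a measure \<Rightarrow> ('a \<Rightarrow> real) \<Rightarrow> ('a \<Rightarrow> real) \<Rightarrow> real \<Rightarrow> real \<Rightarrow> real \<Rightarrow> bool" where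
  "centered_gaussian_pair M V W s11 s12 s22 \<longleftrightarrow>
     (\<forall>u v. (u, v) \<noteq> (0, 0) \<longrightarrow>
        distributed M lborel (\<lambda>\<omega>. u * V \<omega> + v * W \<omega>)
          (normal_density 0 (sqrt (u\<^sup>2 * s11 + 2 * u * v * s12 + v\<^sup>2 * s22))))"


section \<open>The bifurcating autoregressive model\<close>

text \<open>Individuals are the positive integers, the daughters of \<open>n\<close> being \<open>2 * n\<close> and
  \<open>2 * n + 1\<close>; the values \<open>X 0\<close>, \<open>\<epsilon> 0\<close> and \<open>\<epsilon> 1\<close> play no role. The assumption
  \<open>noise_indep_ancestor\<close> is the independence of \<open>X 1\<close> and of the whole sequence of noise pairs,
  written with the generated sigma-algebras because \<^const>\<open>prob_space.indep_var\<close> needs both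
  variables to have values in the same type.\<close>

locale bar_model = prob_space M
  for M :: "'a measure" +
  fixes \<nu> :: "real measure"
    and \<alpha>0 \<beta>0 \<alpha>1 \<beta>1 \<sigma>2 \<rho> :: real
    and X \<epsilon> :: "nat \<Rightarrow> 'a \<Rightarrow> real"
  assumes alpha0: "\<alpha>0 \<in> {-1<..<1}"
    and alpha1: "\<alpha>1 \<in> {-1<..<1}"
    and sigma2: "\<sigma>2 > 0"
    and rho: "\<rho> \<in> {-1<..<1}"
    and ancestor_rv: "random_variable borel (X 1)"
    and ancestor_law: "distr M borel (X 1) = \<nu>"
    and daughter0:
      "\<And>n \<omega>. n \<ge> 1 \<Longrightarrow> \<omega> \<in> space M \<Longrightarrow> X (2 * n) \<omega> = \<alpha>0 * X n \<omega> + \<beta>0 + \<epsilon> (2 * n) \<omega>"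
    and daughter1:
      "\<And>n \<omega>. n \<ge> 1 \<Longrightarrow> \<omega> \<in> space M \<Longrightarrow> X (2 * n + 1) \<omega> = \<alpha>1 * X n \<omega> + \<beta>1 + \<epsilon> (2 * n + 1) \<omega>"
    and noise_gaussian:
      "\<And>n. n \<ge> 1 \<Longrightarrow> centered_gaussian_pair M (\<epsilon> (2 * n)) (\<epsilon> (2 * n + 1)) \<sigma>2 (\<sigma>2 * \<rho>) \<sigma>2"
    and noise_indep:
      "indep_vars (\<lambda>_. borel) (\<lambda>n \<omega>. (\<epsilon> (2 * n) \<omega>, \<epsilon> (2 * n + 1) \<omega>)) {1..}"
    and noise_indep_ancestor:
      "indep_set {X 1 -` A \<inter> space M | A. A \<in> sets borel}
         {(\<lambda>\<omega>. \<lambda>n\<in>{1..}. (\<epsilon> (2 * n) \<omega>, \<epsilon> (2 * n + 1) \<omega>)) -` B \<inter> space M | B.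
            B \<in> sets (PiM {1..} (\<lambda>_. borel))}"


section \<open>Estimators and test statistic\<close>

text \<open>All statistics are functions of the observed values \<open>x :: nat \<Rightarrow> real\<close>. Quotients with a
  vanishing denominator have the value \<open>0\<close>.\<close>

definition tree :: "nat \<Rightarrow> nat set" where
  "tree r = {1..2 ^ (r + 1) - 1}"

definition tree_mean :: "nat \<Rightarrow> (nat \<Rightarrow> real) \<Rightarrow> real" where
  "tree_mean r f = (\<Sum>i\<in>tree r. f i) / real (card (tree r))"

type_synonym bar_param = "real \<times> real \<times> real \<times> real"

text \<open>Parameters \<open>\<theta>\<close> are ordered as \<open>(\<alpha>0, \<beta>0, \<alpha>1, \<beta>1)\<close>.\<close>

fun \<mu>1 :: "bar_param \<Rightarrow> real" where
  "\<mu>1 (a0, b0, a1, b1) = ((b0 + b1) / 2) / (1 - (a0 + a1) / 2)"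

fun \<mu>2 :: "bar_param \<Rightarrow> real \<Rightarrow> real" where
  "\<mu>2 (a0, b0, a1, b1) s2 =
     (let am = (a0 + a1) / 2;
          bm = (b0 + b1) / 2;
          abm = (a0 * b0 + a1 * b1) / 2;
          a2m = (a0\<^sup>2 + a1\<^sup>2) / 2;
          b2m = (b0\<^sup>2 + b1\<^sup>2) / 2
      in (2 * abm * bm / (1 - am) + b2m + s2) / (1 - a2m))"

text \<open>The argument \<open>e \<in> {0, 1}\<close> is the type of the daughter.\<close>

definition alpha_hat :: "nat \<Rightarrow> nat \<Rightarrow> (nat \<Rightarrow> real) \<Rightarrow> real" where
  "alpha_hat e r x =
     (tree_mean r (\<lambda>i. x i * x (2 * i + e)) - tree_mean r x * tree_mean r (\<lambda>i. x (2 * i + e)))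
     / (tree_mean r (\<lambda>i. (x i)\<^sup>2) - (tree_mean r x)\<^sup>2)"

definition beta_hat :: "nat \<Rightarrow> nat \<Rightarrow> (nat \<Rightarrow> real) \<Rightarrow> real" where
  "beta_hat e r x = tree_mean r (\<lambda>i. x (2 * i + e)) - alpha_hat e r x * tree_mean r x"

definition theta_hat :: "nat \<Rightarrow> (nat \<Rightarrow> real) \<Rightarrow> bar_param" where
  "theta_hat r x = (alpha_hat 0 r x, beta_hat 0 r x, alpha_hat 1 r x, beta_hat 1 r x)"

text \<open>The residue of the daughter \<open>2 * n + e\<close>, for \<open>n \<in> tree r\<close>.\<close>

definition bar_residue :: "nat \<Rightarrow> nat \<Rightarrow> (nat \<Rightarrow> real) \<Rightarrow> nat \<Rightarrow> real" where
  "bar_residue e r x n = x (2 * n + e) - alpha_hat e r x * x n - beta_hat e r x"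

definition sigma2_hat :: "nat \<Rightarrow> (nat \<Rightarrow> real) \<Rightarrow> real" where
  "sigma2_hat r x =
     1 / (2 * real (card (tree r))) * (\<Sum>i\<in>tree r. (bar_residue 0 r x i)\<^sup>2 + (bar_residue 1 r x i)\<^sup>2)"

definition rho_hat :: "nat \<Rightarrow> (nat \<Rightarrow> real) \<Rightarrow> real" where
  "rho_hat r x =
     1 / (sigma2_hat r x * real (card (tree r))) * (\<Sum>i\<in>tree r. bar_residue 0 r x i * bar_residue 1 r x i)"

definition \<mu>1_hat :: "nat \<Rightarrow> (nat \<Rightarrow> real) \<Rightarrow> real" where
  "\<mu>1_hat r x = \<mu>1 (theta_hat r x)"

definition \<mu>2_hat :: "nat \<Rightarrow> (nat \<Rightarrow> real) \<Rightarrow> real" where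
  "\<mu>2_hat r x = \<mu>2 (theta_hat r x) (sigma2_hat r x)"

definition chi_stat :: "nat \<Rightarrow> (nat \<Rightarrow> real) \<Rightarrow> real" where
  "chi_stat r x =
     real (card (tree r)) / (2 * sigma2_hat r x * (1 - rho_hat r x)) *
       ((alpha_hat 0 r x - alpha_hat 1 r x)\<^sup>2 * (\<mu>2_hat r x - (\<mu>1_hat r x)\<^sup>2)
        + ((alpha_hat 0 r x - alpha_hat 1 r x) * \<mu>1_hat r x + beta_hat 0 r x - beta_hat 1 r x)\<^sup>2)"

end

theory Submission
  imports Defs
begin

text \<open>Almost sure limits: the partial sums of \<open>X\<^sub>i \<epsilon>\<^sub>i\<close> are sums of orthogonal increments, so their
  means over \<open>tree r\<close> have second moments of order \<open>2^-r\<close> and tend to \<open>0\<close> almost surely; splitting \<open>tree r\<close> into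
  the root and the daughters of \<open>tree (r - 1)\<close> turns the means of \<open>X\<close> and \<open>X\<^sup>2\<close> into perturbed affine
  contractions. All estimators therefore converge, which gives the divergence under the alternative.

  Under the null hypothesis \<open>\<delta>\<^sub>i = X\<^sub>2\<^sub>i - X\<^sub>2\<^sub>i\<^sub>+\<^sub>1\<close> is Gaussian and independent of the past, and the statistic
  is asymptotically the squared norm of two normalised sums, of \<open>\<delta>\<^sub>i\<close> and of \<open>(X\<^sub>i - \<mu>1) \<delta>\<^sub>i\<close>. Their joint
  characteristic function converges because the increments are conditionally Gaussian. Averaging that
  function over a standard normal argument gives the Laplace transform of the squared norm, which
  determines the limit law by the Weierstrass theorem in the variable \<open>exp (- x)\<close>.\<close>

section \<open>Weak convergence\<close>

text \<open>The natural numbers serve as time: the mother of \<open>n\<close> is smaller than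
  \<open>n\<close>, so \<open>X n\<close> depends only on the ancestor and on earlier noises, and a
  sum over \<open>tree r\<close> is the partial sum of one linearly ordered process at the time
  \<open>2 ^ (r + 1) - 1\<close>. The almost sure input is confined to a few limits of tree means;
  the consistency of the estimators is then a deterministic argument along one path, shared by both
  hypotheses. The two normalised sums have a limit in law only, so replacing the estimated
  coefficients of the statistic by their limits is not a pathwise matter: the error is an almost
  surely vanishing factor times a variable with bounded expectation, and it is removed at the level
  of characteristic functions. The leading factor of the statistic estimates the reciprocal of
  \<open>2 * \<sigma>2 * (1 - \<rho>)\<close>, the variance of one difference of noises. Centering
  the second sum at the limit of the means makes the two sums asymptotically uncorrelated, so that
  their limiting covariance is the identity after scaling. The second dimension enters only through
  the argument of one characteristic function; all weak convergence takes place on the real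
  line.\<close>

lemma weak_conv_m_Laplace:
  fixes \<mu> :: "nat \<Rightarrow> real measure" and \<nu> :: "real measure"
  assumes \<mu>: "\<And>n. real_distribution (\<mu> n)" and \<nu>: "real_distribution \<nu>"
    and \<mu>_nonneg: "\<And>n. AE x in \<mu> n. 0 \<le> x" and \<nu>_nonneg: "AE x in \<nu>. 0 \<le> x"
    and lim: "\<And>k::nat. (\<lambda>n. \<integral>x. exp (- (k * x)) \<partial>\<mu> n) \<longlonglongrightarrow> (\<integral>x. exp (- (k * x)) \<partial>\<nu>)"
  shows "weak_conv_m \<mu> \<nu>"
proof (rule integral_cts_step_conv_imp_weak_conv[OF \<mu> \<nu>])
  fix a b :: real assume ab: "a < b"
  \<comment> \<open>\<open>h\<close> is the step function read in the variable
    \<open>y = exp (- x)\<close>. The cut at \<open>exp (- b)\<close> keeps the logarithm away from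
    \<open>y = 0\<close> and changes nothing, because \<open>cts_step a b\<close> vanishes from
    \<open>b\<close> on.\<close>
  define h where "h y = cts_step a b (- ln (max y (exp (- b))))" for y
  have "continuous_on UNIV (cts_step a b)"
    by (rule uniformly_continuous_imp_continuous[OF cts_step_uniformly_continuous[OF ab]])
  moreover have "continuous_on {0..1} (\<lambda>y. - ln (max y (exp (- b))))"
    by (intro continuous_intros) (auto simp: max_def)
  ultimately have h: "continuous_on {0..1} h"
    unfolding h_def by (rule continuous_on_compose2) auto
  have h_eq: "h (exp (- x)) = cts_step a b x" for x
    using ab by (cases "x \<le> b") (auto simp: h_def max_def cts_step_def)
  have step_int: "integrable N (cts_step a b)" if "real_distribution N" for N
    using real_distribution.integrable_cts_step[OF that ab] .
  have exp_int: "integrable N (\<lambda>x. exp (- (real k * x)))"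
    if N: "real_distribution N" "AE x in N. 0 \<le> x" for N k
  proof -
    interpret real_distribution N by fact
    show ?thesis
      by (rule integrable_const_bound[of _ 1]) (use N(2) in \<open>auto elim!: eventually_mono\<close>)
  qed
  show "(\<lambda>n. integral\<^sup>L (\<mu> n) (cts_step a b)) \<longlonglongrightarrow> integral\<^sup>L \<nu> (cts_step a b)"
  proof (rule LIMSEQ_I)
    fix e :: real assume e: "0 < e"
    obtain g where g: "real_polynomial_function g" "\<And>y. y \<in> {0..1} \<Longrightarrow> \<bar>h y - g y\<bar> < e / 3"
      using Stone_Weierstrass_real_polynomial_function[OF compact_Icc h, of "e / 3"] e by auto
    then obtain c m where gc: "g = (\<lambda>x. \<Sum>i\<le>(m::nat). c i * x ^ i)"
      unfolding real_polynomial_function_iff_sum by blast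
    \<comment> \<open>A polynomial in \<open>exp (- x)\<close> is a linear combination of Laplace
      kernels, which is why the transform at natural arguments determines the limit.\<close>
    have g_exp: "g (exp (- x)) = (\<Sum>i\<le>m. c i * exp (- (real i * x)))" for x
      by (simp add: gc flip: exp_of_nat_mult)
    have g_int: "integrable N (\<lambda>x. g (exp (- x)))"
      and g_integral: "(\<integral>x. g (exp (- x)) \<partial>N) = (\<Sum>i\<le>m. c i * (\<integral>x. exp (- (real i * x)) \<partial>N))"
      and close: "\<bar>integral\<^sup>L N (cts_step a b) - (\<integral>x. g (exp (- x)) \<partial>N)\<bar> \<le> e / 3"
      if N: "real_distribution N" "AE x in N. 0 \<le> x" for N
    proof -
      interpret real_distribution N by fact
      note [simp] = exp_int[OF N] step_int[OF N(1)]
      show int: "integrable N (\<lambda>x. g (exp (- x)))"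
        unfolding g_exp by simp
      show "(\<integral>x. g (exp (- x)) \<partial>N) = (\<Sum>i\<le>m. c i * (\<integral>x. exp (- (real i * x)) \<partial>N))"
        unfolding g_exp by simp
      have "\<bar>(\<integral>x. cts_step a b x - g (exp (- x)) \<partial>N)\<bar> \<le> (\<integral>x. \<bar>cts_step a b x - g (exp (- x))\<bar> \<partial>N)"
        by (rule integral_abs_bound)
      also have "\<dots> \<le> (\<integral>x. e / 3 \<partial>N)"
      proof (rule integral_mono_AE)
        show "AE x in N. \<bar>cts_step a b x - g (exp (- x))\<bar> \<le> e / 3"
          using N(2) by eventually_elim (use g(2)[of "exp (- _)"] in \<open>auto simp: h_eq less_imp_le\<close>)
      qed (use int in auto)
      finally show "\<bar>integral\<^sup>L N (cts_step a b) - (\<integral>x. g (exp (- x)) \<partial>N)\<bar> \<le> e / 3"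
        using int prob_space by simp
    qed
    have "(\<lambda>n. \<integral>x. g (exp (- x)) \<partial>\<mu> n) \<longlonglongrightarrow> (\<integral>x. g (exp (- x)) \<partial>\<nu>)"
      unfolding g_integral[OF \<mu> \<mu>_nonneg] g_integral[OF \<nu> \<nu>_nonneg] by (intro tendsto_intros lim)
    from LIMSEQ_D[OF this, of "e / 3"] e obtain n0 where
      n0: "\<And>n. n \<ge> n0 \<Longrightarrow> norm ((\<integral>x. g (exp (- x)) \<partial>\<mu> n) - (\<integral>x. g (exp (- x)) \<partial>\<nu>)) < e / 3" by auto
    show "\<exists>n0. \<forall>n\<ge>n0. norm (integral\<^sup>L (\<mu> n) (cts_step a b) - integral\<^sup>L \<nu> (cts_step a b)) < e"
    proof (intro exI allI impI)
      fix n assume "n0 \<le> n"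
      from n0[OF this] close[OF \<mu> \<mu>_nonneg, of n] close[OF \<nu> \<nu>_nonneg]
      show "norm (integral\<^sup>L (\<mu> n) (cts_step a b) - integral\<^sup>L \<nu> (cts_step a b)) < e"
        unfolding real_norm_def abs_le_iff abs_less_iff by linarith
    qed
  qed
qed

lemma prob_space_std_normal: "prob_space (density lborel std_normal_density)"
  by (rule prob_space_normal_density) simp

lemma real_distribution_chi_square: "real_distribution (chi_square d)"
proof -
  interpret prob_space "PiM {..<d} (\<lambda>_. density lborel std_normal_density)"
    by (intro prob_space_PiM prob_space_std_normal)
  show ?thesis
    unfolding chi_square_def by (intro real_distribution_distr) simp
qed

text \<open>Averaging the characteristic function over a standard normal vector \<open>z\<close> gives the
  Laplace transform of the squared norm.\<close>

lemma weak_conv_m_chi_square: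
  fixes P :: "nat \<Rightarrow> nat \<Rightarrow> 'a \<Rightarrow> real"
  assumes M: "prob_space M" and P[measurable]: "\<And>r i. P r i \<in> borel_measurable M"
    and lim: "\<And>z. (\<lambda>r. \<integral>\<omega>. iexp (\<Sum>i<d. z i * P r i \<omega>) \<partial>M)
      \<longlonglongrightarrow> of_real (exp (- (\<Sum>i<d. (z i)\<^sup>2) / 2))"
  shows "weak_conv_m (\<lambda>r. distr M borel (\<lambda>\<omega>. \<Sum>i<d. (P r i \<omega>)\<^sup>2)) (chi_square d)"
proof (rule weak_conv_m_Laplace)
  let ?G = "PiM {..<d} (\<lambda>_::nat. density lborel std_normal_density)"
  interpret M: prob_space M by fact
  interpret N: prob_space "density lborel std_normal_density" by (rule prob_space_std_normal)
  interpret PN: product_sigma_finite "\<lambda>_::nat. density lborel std_normal_density" ..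
  interpret G: prob_space ?G by (intro prob_space_PiM prob_space_std_normal)
  interpret MG: pair_prob_space M ?G ..
  show "real_distribution (distr M borel (\<lambda>\<omega>. \<Sum>i<d. (P r i \<omega>)\<^sup>2))" for r
    by (intro M.real_distribution_distr) simp
  show "real_distribution (chi_square d)"
    by (rule real_distribution_chi_square)
  show "AE x in distr M borel (\<lambda>\<omega>. \<Sum>i<d. (P r i \<omega>)\<^sup>2). 0 \<le> x" for r
    by (subst AE_distr_iff) (auto intro!: AE_I2 sum_nonneg)
  show "AE x in chi_square d. 0 \<le> x"
    unfolding chi_square_def by (subst AE_distr_iff) (auto intro!: AE_I2 sum_nonneg)
  fix k :: nat
  \<comment> \<open>Scaling the Gaussian argument by \<open>c\<close> turns its characteristic
    function \<open>exp (- (c * p)\<^sup>2 / 2)\<close> into the Laplace kernel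
    \<open>exp (- (k * p\<^sup>2))\<close>.\<close>
  define c where "c = sqrt (2 * real k)"
  have c2: "c\<^sup>2 = 2 * real k" by (simp add: c_def)
  have gauss: "(\<integral>z. iexp (\<Sum>i<d. c * z i * p i) \<partial>?G) = of_real (exp (- (k * (\<Sum>i<d. (p i)\<^sup>2))))"
    for p :: "nat \<Rightarrow> real"
  proof -
    have "(\<integral>z. iexp (\<Sum>i<d. c * z i * p i) \<partial>?G) = (\<integral>z. (\<Prod>i<d. iexp ((c * p i) * z i)) \<partial>?G)"
      by (simp add: sum_distrib_left exp_sum mult_ac)
    also have "\<dots> = (\<Prod>i<d. \<integral>x. iexp ((c * p i) * x) \<partial>density lborel std_normal_density)"
      by (intro PN.product_integral_prod) (auto intro!: N.integrable_iexp)
    also have "\<dots> = (\<Prod>i<d. of_real (exp (- (c * p i)\<^sup>2 / 2)))"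
      using char_std_normal_distribution unfolding char_def fun_eq_iff
      by (intro prod.cong refl) (metis minus_divide_left)
    also have "\<dots> = of_real (exp (- (k * (\<Sum>i<d. (p i)\<^sup>2))))"
      by (simp add: power_mult_distrib c2 sum_distrib_left flip: of_real_prod exp_sum sum_negf)
    finally show ?thesis .
  qed
  have eq: "complex_of_real (\<integral>x. exp (- (k * x)) \<partial>distr M borel (\<lambda>\<omega>. \<Sum>i<d. (P r i \<omega>)\<^sup>2)) =
      (\<integral>z. \<integral>\<omega>. iexp (\<Sum>i<d. c * z i * P r i \<omega>) \<partial>M \<partial>?G)" for r
  proof -
    have "complex_of_real (\<integral>x. exp (- (k * x)) \<partial>distr M borel (\<lambda>\<omega>. \<Sum>i<d. (P r i \<omega>)\<^sup>2)) =
      (\<integral>\<omega>. of_real (exp (- (k * (\<Sum>i<d. (P r i \<omega>)\<^sup>2)))) \<partial>M)"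
      by (simp add: integral_distr)
    also have "\<dots> = (\<integral>\<omega>. \<integral>z. iexp (\<Sum>i<d. c * z i * P r i \<omega>) \<partial>?G \<partial>M)"
      unfolding gauss ..
    also have "\<dots> = (\<integral>z. \<integral>\<omega>. iexp (\<Sum>i<d. c * z i * P r i \<omega>) \<partial>M \<partial>?G)"
      by (rule MG.Fubini_integral[symmetric])
        (auto intro!: MG.P.integrable_const_bound[of _ 1] simp: split_beta')
    finally show ?thesis .
  qed
  have "(\<lambda>r. \<integral>z. \<integral>\<omega>. iexp (\<Sum>i<d. c * z i * P r i \<omega>) \<partial>M \<partial>?G)
     \<longlonglongrightarrow> (\<integral>z. of_real (exp (- (\<Sum>i<d. (c * z i)\<^sup>2) / 2)) \<partial>?G)"
  proof (rule integral_dominated_convergence)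
    show "AE z in ?G. (\<lambda>r. \<integral>\<omega>. iexp (\<Sum>i<d. c * z i * P r i \<omega>) \<partial>M)
        \<longlonglongrightarrow> of_real (exp (- (\<Sum>i<d. (c * z i)\<^sup>2) / 2))"
      by (intro AE_I2 lim)
    show "AE z in ?G. norm (\<integral>\<omega>. iexp (\<Sum>i<d. c * z i * P r i \<omega>) \<partial>M) \<le> 1" for r
    proof (rule AE_I2)
      fix z
      have "norm (\<integral>\<omega>. iexp (\<Sum>i<d. c * z i * P r i \<omega>) \<partial>M)
          \<le> (\<integral>\<omega>. norm (iexp (\<Sum>i<d. c * z i * P r i \<omega>)) \<partial>M)"
        by (rule integral_norm_bound)
      then show "norm (\<integral>\<omega>. iexp (\<Sum>i<d. c * z i * P r i \<omega>) \<partial>M) \<le> 1"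
        by (simp add: M.prob_space)
    qed
  qed auto
  \<comment> \<open>The same scaling read backwards: the exponent of the limit is \<open>k\<close>
    times the squared norm of \<open>z\<close>, so the limit is already the transform of
    \<open>chi_square d\<close>, without an explicit formula for it.\<close>
  also have "(\<integral>z. of_real (exp (- (\<Sum>i<d. (c * z i)\<^sup>2) / 2)) \<partial>?G) =
      complex_of_real (\<integral>x. exp (- (k * x)) \<partial>chi_square d)"
    by (simp add: chi_square_def integral_distr power_mult_distrib c2 mult.assoc flip: sum_distrib_left)
  finally show "(\<lambda>r. \<integral>x. exp (- (k * x)) \<partial>distr M borel (\<lambda>\<omega>. \<Sum>i<d. (P r i \<omega>)\<^sup>2))
      \<longlonglongrightarrow> (\<integral>x. exp (- (k * x)) \<partial>chi_square d)"
    by (subst (asm) eq[symmetric]) (simp only: tendsto_of_real_iff)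
qed

text \<open>A Slutsky argument for an error bounded by an almost surely vanishing factor times a
  nonnegative variable that is bounded only in mean. Where the factor is below a small level, the
  mean of \<open>T r\<close> controls the error; elsewhere two characters differ by at most 2, and
  these places lose their weight.\<close>

lemma weak_conv_m_perturb:
  fixes Q Y T :: "nat \<Rightarrow> 'a \<Rightarrow> real"
  assumes M: "prob_space M"
    and [measurable]: "\<And>r. Q r \<in> borel_measurable M" "\<And>r. Y r \<in> borel_measurable M"
    and N: "real_distribution N" and Q: "weak_conv_m (\<lambda>r. distr M borel (Q r)) N"
    and bound: "AE \<omega> in M. \<exists>D. D \<longlonglongrightarrow> 0 \<and> (\<forall>r. \<bar>Y r \<omega> - Q r \<omega>\<bar> \<le> D r * T r \<omega>)"
    and T: "\<And>r. integrable M (T r)" "\<And>r \<omega>. 0 \<le> T r \<omega>" "\<And>r. integral\<^sup>L M (T r) \<le> C"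
  shows "weak_conv_m (\<lambda>r. distr M borel (Y r)) N"
proof (rule levy_continuity)
  \<comment> \<open>The factor given by \<open>bound\<close> is chosen path by path, with no
    measurability in \<open>\<omega>\<close>. The quotient is the least admissible factor and is
    measurable. Where \<open>T r \<omega> = 0\<close> it takes the default value 0, and there the
    error vanishes too.\<close>
  define D where "D r \<omega> = \<bar>Y r \<omega> - Q r \<omega>\<bar> / T r \<omega>" for r \<omega>
  have [measurable]: "T r \<in> borel_measurable M" for r
    using T(1) by auto
  have [measurable]: "D r \<in> borel_measurable M" for r
    unfolding D_def[abs_def] by measurable
  have D_nonneg: "0 \<le> D r \<omega>" for r \<omega>
    using T(2) by (simp add: D_def)
  have D: "AE \<omega> in M. (\<lambda>r. D r \<omega>) \<longlonglongrightarrow> 0 \<and> (\<forall>r. \<bar>Y r \<omega> - Q r \<omega>\<bar> \<le> D r \<omega> * T r \<omega>)"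
    using bound
  proof eventually_elim
    fix \<omega> assume "\<exists>D. D \<longlonglongrightarrow> 0 \<and> (\<forall>r. \<bar>Y r \<omega> - Q r \<omega>\<bar> \<le> D r * T r \<omega>)"
    then obtain d where d: "d \<longlonglongrightarrow> 0" "\<And>r. \<bar>Y r \<omega> - Q r \<omega>\<bar> \<le> d r * T r \<omega>" by blast
    have "D r \<omega> \<le> \<bar>d r\<bar>" for r
    proof (cases "T r \<omega> = 0")
      case False
      then have "0 < T r \<omega>" using T(2)[of r \<omega>] by simp
      then have "D r \<omega> \<le> d r" using d(2)[of r] by (simp add: D_def pos_divide_le_eq)
      then show ?thesis by simp
    qed (simp add: D_def)
    then have "(\<lambda>r. D r \<omega>) \<longlonglongrightarrow> 0"
      using D_nonneg by (intro Lim_null_comparison[OF _ tendsto_rabs_zero[OF d(1)]]) auto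
    moreover have "\<bar>Y r \<omega> - Q r \<omega>\<bar> \<le> D r \<omega> * T r \<omega>" for r
      using d(2)[of r] by (cases "T r \<omega> = 0") (auto simp: D_def)
    ultimately show "(\<lambda>r. D r \<omega>) \<longlonglongrightarrow> 0 \<and> (\<forall>r. \<bar>Y r \<omega> - Q r \<omega>\<bar> \<le> D r \<omega> * T r \<omega>)"
      by blast
  qed
  interpret prob_space M by fact
  show distr: "real_distribution (distr M borel (Y r))" for r
    by (intro real_distribution_distr) simp
  have distrQ: "real_distribution (distr M borel (Q r))" for r
    by (intro real_distribution_distr) simp
  show "real_distribution N" by fact
  fix t :: real
  have charQ: "(\<lambda>r. char (distr M borel (Q r)) t) \<longlonglongrightarrow> char N t"
    by (rule levy_continuity1[OF distrQ N Q])
  have iexp_int: "integrable M (\<lambda>\<omega>. iexp (t * f \<omega>))" if "f \<in> borel_measurable M" for f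
    using that by (intro integrable_iexp) auto
  have "(\<lambda>r. char (distr M borel (Y r)) t - char (distr M borel (Q r)) t) \<longlonglongrightarrow> 0"
  proof (rule LIMSEQ_I)
    fix e :: real assume e: "0 < e"
    \<comment> \<open>With this level, the part of the error where
      \<open>D r \<omega> \<le> \<eta>\<close> contributes at most \<open>e / 2\<close>; the added 1
      keeps the denominator positive.\<close>
    define \<eta> where "\<eta> = e / (2 * (\<bar>t\<bar> * \<bar>C\<bar> + 1))"
    have pos: "\<bar>t\<bar> * \<bar>C\<bar> + 1 > 0"
      by (intro add_nonneg_pos) auto
    then have \<eta>: "\<eta> > 0" "\<eta> * (\<bar>t\<bar> * \<bar>C\<bar> + 1) = e / 2"
      using e by (simp_all add: \<eta>_def field_simps)
    \<comment> \<open>The truncated quotient equals 2 wherever \<open>D r \<omega>\<close> exceeds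
      \<open>\<eta>\<close>, so it dominates the difference of the characters there, and unlike an
      indicator it is continuous in \<open>D r \<omega>\<close>.\<close>
    have "(\<lambda>r. \<integral>\<omega>. min 2 (2 * D r \<omega> / \<eta>) \<partial>M) \<longlonglongrightarrow> (\<integral>\<omega>. 0 \<partial>M)"
    proof (rule integral_dominated_convergence)
      show "AE \<omega> in M. (\<lambda>r. min 2 (2 * D r \<omega> / \<eta>)) \<longlonglongrightarrow> 0"
        using D
      proof eventually_elim
        fix \<omega> assume "(\<lambda>r. D r \<omega>) \<longlonglongrightarrow> 0 \<and> (\<forall>r. \<bar>Y r \<omega> - Q r \<omega>\<bar> \<le> D r \<omega> * T r \<omega>)"
        then have "(\<lambda>r. D r \<omega>) \<longlonglongrightarrow> 0" ..
        then have "(\<lambda>r. min 2 (2 * D r \<omega> / \<eta>)) \<longlonglongrightarrow> min 2 (2 * 0 / \<eta>)"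
          by (intro tendsto_intros) (use \<eta> in auto)
        then show "(\<lambda>r. min 2 (2 * D r \<omega> / \<eta>)) \<longlonglongrightarrow> 0" by simp
      qed
      show "AE \<omega> in M. norm (min 2 (2 * D r \<omega> / \<eta>)) \<le> 2" for r
        using D_nonneg \<eta> by (intro AE_I2) auto
    qed auto
    from LIMSEQ_D[OF this, of "e / 2"] e obtain n0 where
      n0: "\<And>r. r \<ge> n0 \<Longrightarrow> \<bar>\<integral>\<omega>. min 2 (2 * D r \<omega> / \<eta>) \<partial>M\<bar> < e / 2" by auto
    show "\<exists>n0. \<forall>r\<ge>n0. norm (char (distr M borel (Y r)) t - char (distr M borel (Q r)) t - 0) < e"
    proof (intro exI allI impI)
      fix r assume r: "n0 \<le> r"
      have minint: "integrable M (\<lambda>\<omega>. min 2 (2 * D r \<omega> / \<eta>))"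
        using D_nonneg \<eta> by (intro integrable_const_bound[of _ 2]) auto
      have "char (distr M borel (Y r)) t - char (distr M borel (Q r)) t =
          (\<integral>\<omega>. iexp (t * Y r \<omega>) - iexp (t * Q r \<omega>) \<partial>M)"
        by (subst Bochner_Integration.integral_diff) (rule iexp_int | simp add: char_def integral_distr)+
      also have "norm \<dots> \<le> (\<integral>\<omega>. norm (iexp (t * Y r \<omega>) - iexp (t * Q r \<omega>)) \<partial>M)"
        by (rule integral_norm_bound)
      also have "\<dots> \<le> (\<integral>\<omega>. \<bar>t\<bar> * \<eta> * T r \<omega> + min 2 (2 * D r \<omega> / \<eta>) \<partial>M)"
      proof (rule integral_mono_AE)
        show "AE \<omega> in M. norm (iexp (t * Y r \<omega>) - iexp (t * Q r \<omega>)) \<le>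
            \<bar>t\<bar> * \<eta> * T r \<omega> + min 2 (2 * D r \<omega> / \<eta>)"
          using D
        proof eventually_elim
          fix \<omega> assume "(\<lambda>r. D r \<omega>) \<longlonglongrightarrow> 0 \<and> (\<forall>r. \<bar>Y r \<omega> - Q r \<omega>\<bar> \<le> D r \<omega> * T r \<omega>)"
          then have bd: "\<bar>Y r \<omega> - Q r \<omega>\<bar> \<le> D r \<omega> * T r \<omega>" by blast
          have 1: "norm (iexp (t * Y r \<omega>) - iexp (t * Q r \<omega>)) \<le> \<bar>t\<bar> * \<bar>Y r \<omega> - Q r \<omega>\<bar>"
          proof -
            have "iexp (t * Y r \<omega>) - iexp (t * Q r \<omega>) =
                iexp (t * Q r \<omega>) * (iexp (t * (Y r \<omega> - Q r \<omega>)) - 1)"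
              by (simp add: algebra_simps flip: exp_add)
            then have "norm (iexp (t * Y r \<omega>) - iexp (t * Q r \<omega>)) = norm (iexp (t * (Y r \<omega> - Q r \<omega>)) - 1)"
              by (simp add: norm_mult)
            also have "\<dots> \<le> \<bar>t * (Y r \<omega> - Q r \<omega>)\<bar>"
              using iexp_approx1[of "t * (Y r \<omega> - Q r \<omega>)" 0] by simp
            finally show ?thesis by (simp add: abs_mult)
          qed
          have 2: "norm (iexp (t * Y r \<omega>) - iexp (t * Q r \<omega>)) \<le> 2"
            using norm_triangle_ineq4[of "iexp (t * Y r \<omega>)" "iexp (t * Q r \<omega>)"] by simp
          show "norm (iexp (t * Y r \<omega>) - iexp (t * Q r \<omega>)) \<le> \<bar>t\<bar> * \<eta> * T r \<omega> + min 2 (2 * D r \<omega> / \<eta>)"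
          proof (cases "D r \<omega> \<le> \<eta>")
            case True
            have "\<bar>Y r \<omega> - Q r \<omega>\<bar> \<le> \<eta> * T r \<omega>"
              using bd mult_right_mono[OF True T(2)[of r \<omega>]] by linarith
            then have "\<bar>t\<bar> * \<bar>Y r \<omega> - Q r \<omega>\<bar> \<le> \<bar>t\<bar> * (\<eta> * T r \<omega>)"
              by (intro mult_left_mono) auto
            moreover have "0 \<le> min 2 (2 * D r \<omega> / \<eta>)"
              using D_nonneg[of r \<omega>] \<eta> by simp
            ultimately show ?thesis using 1 by (simp add: mult.assoc)
          next
            case False
            then have "min 2 (2 * D r \<omega> / \<eta>) = 2"
              using \<eta> by (simp add: min_def field_simps)
            then show ?thesis
              using 2 \<eta> T(2)[of r \<omega>] by (simp add: add_increasing)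
          qed
        qed
      qed (use T(1) minint iexp_int in auto)
      also have "\<dots> = \<bar>t\<bar> * \<eta> * integral\<^sup>L M (T r) + (\<integral>\<omega>. min 2 (2 * D r \<omega> / \<eta>) \<partial>M)"
        using T(1) minint by simp
      also have "\<dots> < e"
      proof -
        have "\<bar>t\<bar> * \<eta> * integral\<^sup>L M (T r) \<le> \<bar>t\<bar> * \<eta> * \<bar>C\<bar>"
          using T(3)[of r] \<eta> by (intro mult_left_mono) auto
        also have "\<dots> \<le> e / 2"
          using \<eta> by (simp add: algebra_simps)
        finally show ?thesis using n0[OF r] by linarith
      qed
      finally show "norm (char (distr M borel (Y r)) t - char (distr M borel (Q r)) t - 0) < e" by simp
    qed
  qed
  from tendsto_add[OF this charQ] show "(\<lambda>r. char (distr M borel (Y r)) t) \<longlonglongrightarrow> char N t" by simp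
qed

section \<open>Almost sure convergence and perturbed contractions\<close>

lemma AE_tendsto_zero_geometric:
  fixes Y :: "nat \<Rightarrow> 'a \<Rightarrow> real"
  assumes int: "\<And>r. integrable M (\<lambda>\<omega>. (Y r \<omega>)\<^sup>2)"
    and bound: "\<And>r. (\<integral>\<omega>. (Y r \<omega>)\<^sup>2 \<partial>M) \<le> C * q ^ r" and q: "0 \<le> q" "q < 1"
  shows "AE \<omega> in M. (\<lambda>r. Y r \<omega>) \<longlonglongrightarrow> 0"
proof -
  have [measurable]: "(\<lambda>\<omega>. (Y r \<omega>)\<^sup>2) \<in> borel_measurable M" for r
    using int by auto
  have sumq: "summable (\<lambda>r. C * q ^ r)"
    using q by (intro summable_mult summable_geometric) auto
  have nonneg: "0 \<le> C * q ^ r" for r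
  proof -
    have "0 \<le> (\<integral>\<omega>. (Y r \<omega>)\<^sup>2 \<partial>M)" by simp
    then show ?thesis using bound[of r] by linarith
  qed
  \<comment> \<open>The series of the squares has finite expectation, hence is almost surely finite,
    and then its terms tend to 0.\<close>
  have "(\<integral>\<^sup>+\<omega>. (\<Sum>r. ennreal ((Y r \<omega>)\<^sup>2)) \<partial>M) = (\<Sum>r. \<integral>\<^sup>+\<omega>. ennreal ((Y r \<omega>)\<^sup>2) \<partial>M)"
    by (rule nn_integral_suminf) simp
  also have "\<dots> \<le> (\<Sum>r. ennreal (C * q ^ r))"
    by (intro suminf_le) (auto simp: nn_integral_eq_integral[OF int] bound ennreal_leI)
  also have "\<dots> < \<infinity>"
    using suminf_ennreal2[OF nonneg sumq] by simp
  finally have "AE \<omega> in M. (\<Sum>r. ennreal ((Y r \<omega>)\<^sup>2)) \<noteq> \<infinity>"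
    by (intro nn_integral_PInf_AE) auto
  then show ?thesis
  proof eventually_elim
    fix \<omega> assume "(\<Sum>r. ennreal ((Y r \<omega>)\<^sup>2)) \<noteq> \<infinity>"
    then have "summable (\<lambda>r. (Y r \<omega>)\<^sup>2)"
      by (intro summable_suminf_not_top) auto
    from summable_LIMSEQ_zero[OF this] show "(\<lambda>r. Y r \<omega>) \<longlonglongrightarrow> 0"
      using tendsto_real_sqrt by fastforce
  qed
qed

text \<open>The limit is the fixed point of the limiting affine map. The distance to it obeys a
  recursion whose factor is eventually at most some \<open>q < 1\<close> in absolute value and whose
  additive part \<open>d r\<close>, the defect of the fixed point at step \<open>r\<close>,
  vanishes.\<close>

lemma contraction_tendsto:
  fixes m a b :: "nat \<Rightarrow> real"
  assumes rec: "\<And>r. m (Suc r) = a r * m r + b r"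
    and a: "a \<longlonglongrightarrow> \<alpha>" and \<alpha>: "\<bar>\<alpha>\<bar> < 1" and b: "b \<longlonglongrightarrow> \<beta>"
  shows "m \<longlonglongrightarrow> \<beta> / (1 - \<alpha>)"
proof -
  define l where "l = \<beta> / (1 - \<alpha>)"
  define d where "d r = b r - (1 - a r) * l" for r
  define q where "q = (1 + \<bar>\<alpha>\<bar>) / 2"
  have q: "\<bar>\<alpha>\<bar> < q" "q < 1" "0 < q"
    using \<alpha> by (auto simp: q_def)
  have d: "d \<longlonglongrightarrow> 0"
  proof -
    have "d \<longlonglongrightarrow> \<beta> - (1 - \<alpha>) * l"
      unfolding d_def by (intro tendsto_intros a b)
    then show ?thesis using \<alpha> by (simp add: l_def)
  qed
  have rec': "m (Suc r) - l = a r * (m r - l) + d r" for r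
    by (simp add: rec d_def algebra_simps)
  have "eventually (\<lambda>r. \<bar>a r\<bar> < q) sequentially"
    using order_tendstoD(2)[OF tendsto_rabs[OF a] q(1)] .
  then obtain n1 where n1: "\<And>r. r \<ge> n1 \<Longrightarrow> \<bar>a r\<bar> < q"
    by (auto simp: eventually_sequentially)
  have "(\<lambda>r. m r - l) \<longlonglongrightarrow> 0"
  proof (rule LIMSEQ_I)
    fix e :: real assume e: "0 < e"
    then have "0 < e / 2 * (1 - q)" using q by simp
    from LIMSEQ_D[OF d this] obtain n2 where n2: "\<And>r. r \<ge> n2 \<Longrightarrow> \<bar>d r\<bar> < e / 2 * (1 - q)" by auto
    define n where "n = max n1 n2"
    \<comment> \<open>The defect was required to be below \<open>e / 2 * (1 - q)\<close> because
      \<open>e / 2\<close> is then the fixed point of the bounding map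
      \<open>y \<mapsto> q * y + e / 2 * (1 - q)\<close>, so defects never accumulate beyond
      \<open>e / 2\<close>.\<close>
    have step: "\<bar>m (n + j) - l\<bar> \<le> q ^ j * \<bar>m n - l\<bar> + e / 2" for j
    proof (induction j)
      case (Suc j)
      have "\<bar>m (n + Suc j) - l\<bar> \<le> \<bar>a (n + j)\<bar> * \<bar>m (n + j) - l\<bar> + \<bar>d (n + j)\<bar>"
        using rec'[of "n + j"] by (metis abs_mult abs_triangle_ineq add_Suc_right)
      also have "\<dots> \<le> q * (q ^ j * \<bar>m n - l\<bar> + e / 2) + e / 2 * (1 - q)"
        using n1[of "n + j"] n2[of "n + j"] Suc q
        by (intro add_mono mult_mono) (auto simp: n_def intro!: less_imp_le)
      also have "\<dots> = q ^ Suc j * \<bar>m n - l\<bar> + e / 2"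
        by (simp add: field_simps)
      finally show ?case .
    qed (use e in simp)
    have "(\<lambda>j. q ^ j * \<bar>m n - l\<bar>) \<longlonglongrightarrow> 0 * \<bar>m n - l\<bar>"
      using q by (intro tendsto_intros LIMSEQ_realpow_zero) auto
    from LIMSEQ_D[OF this, of "e / 2"] e obtain n3 where
      n3: "\<And>j. j \<ge> n3 \<Longrightarrow> \<bar>q ^ j * \<bar>m n - l\<bar>\<bar> < e / 2" by auto
    show "\<exists>n0. \<forall>r\<ge>n0. norm (m r - l - 0) < e"
    proof (intro exI allI impI)
      fix r assume r: "n + n3 \<le> r"
      have "q ^ (r - n) * \<bar>m n - l\<bar> < e / 2"
        using r by (intro order.strict_trans1[OF abs_ge_self n3]) simp
      then show "norm (m r - l - 0) < e"
        using step[of "r - n"] r by simp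
    qed
  qed
  then show ?thesis
    unfolding l_def by (simp add: LIM_zero_iff)
qed

section \<open>Means over the tree\<close>

lemma card_tree: "real (card (tree r)) = 2 ^ (r + 1) - 1"
  by (simp add: tree_def of_nat_diff)

lemma card_tree_pos: "0 < real (card (tree r))"
  using one_le_power[of "2::real" r] by (simp add: card_tree del: one_le_power) 

lemma filterlim_card_tree: "filterlim (\<lambda>r. real (card (tree r))) at_top sequentially"
proof (rule filterlim_at_top_mono)
  show "filterlim (\<lambda>r. real r) at_top sequentially"
    by (rule filterlim_real_sequentially)
  show "\<forall>\<^sub>F r in sequentially. real r \<le> real (card (tree r))"
  proof (intro always_eventually allI)
    fix r
    have "real r < 2 ^ r" by simp
    moreover have "(1::real) \<le> 2 ^ r" by simp
    ultimately show "real r \<le> real (card (tree r))"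
      unfolding card_tree Suc_eq_plus1[symmetric] power_Suc by linarith
  qed
qed

lemma tree_mean_cong: "(\<And>i. 1 \<le> i \<Longrightarrow> f i = g i) \<Longrightarrow> tree_mean r f = tree_mean r g"
  by (auto simp: tree_mean_def tree_def intro!: arg_cong2[where f = "(/)"] sum.cong)

lemma tree_mean_add: "tree_mean r (\<lambda>i. f i + g i) = tree_mean r f + tree_mean r g"
  by (simp add: tree_mean_def sum.distrib add_divide_distrib)

lemma tree_mean_diff: "tree_mean r (\<lambda>i. f i - g i) = tree_mean r f - tree_mean r g"
  by (simp add: tree_mean_def sum_subtractf diff_divide_distrib)

lemma tree_mean_cmult: "tree_mean r (\<lambda>i. c * f i) = c * tree_mean r f"
  by (simp add: tree_mean_def flip: sum_distrib_left)

lemma tree_mean_const: "tree_mean r (\<lambda>i. c) = c"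
  using card_tree_pos[of r] by (simp add: tree_mean_def)

text \<open>Each inductive step adds exactly \<open>2 * m\<close> and \<open>2 * m + 1\<close>, the
  daughters of \<open>m\<close>.\<close>

lemma sum_daughters:
  fixes f :: "nat \<Rightarrow> real"
  assumes "1 \<le> m"
  shows "(\<Sum>i=1..<2 * m. f i) = f 1 + (\<Sum>i=1..<m. f (2 * i) + f (2 * i + 1))"
  using assms
proof (induction m rule: dec_induct)
  case (step m)
  have "2 * Suc m = Suc (Suc (2 * m))" by simp
  then show ?case
    using step by (simp only: sum.atLeastLessThan_Suc) (simp add: sum.atLeastLessThan_Suc)
qed (simp add: numeral_2_eq_2)

lemma tree_mean_Suc:
  "tree_mean (Suc r) f = f 1 / card (tree (Suc r)) +
    (card (tree r) / card (tree (Suc r))) * (tree_mean r (\<lambda>i. f (2 * i)) + tree_mean r (\<lambda>i. f (2 * i + 1)))"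
proof -
  have *: "tree r = {1..<2 ^ (r + 1)}" for r
    unfolding tree_def by (rule atLeastLessThanSuc_atLeastAtMost[symmetric, THEN trans]) simp
  have "(\<Sum>i\<in>tree (Suc r). f i) = f 1 + (\<Sum>i\<in>tree r. f (2 * i)) + (\<Sum>i\<in>tree r. f (2 * i + 1))"
    using sum_daughters[of "2 ^ (r + 1)" f] by (simp add: * sum.distrib)
  then show ?thesis
    using card_tree_pos[of r] by (simp add: tree_mean_def add_divide_distrib distrib_left)
qed

lemma card_tree_ratio: "(\<lambda>r. real (card (tree r)) / card (tree (Suc r))) \<longlonglongrightarrow> 1 / 2"
proof -
  \<comment> \<open>If \<open>tree (Suc r)\<close> has \<open>N\<close> vertices, then
    \<open>tree r\<close> has \<open>(N - 1) / 2\<close>.\<close>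
  have "(\<lambda>r. 1 / 2 - 1 / 2 * (1 / real (card (tree (Suc r))))) \<longlonglongrightarrow> 1 / 2 - 1 / 2 * 0"
    by (intro tendsto_intros real_tendsto_divide_at_top[OF tendsto_const]
        filterlim_compose[OF filterlim_card_tree filterlim_Suc])
  moreover have "1 / 2 - 1 / 2 * (1 / real (card (tree (Suc r)))) = real (card (tree r)) / card (tree (Suc r))" for r
    using card_tree_pos[of "Suc r"] by (simp add: card_tree field_simps)
  ultimately show ?thesis by simp
qed

lemma inverse_card_tendsto: "(\<lambda>r. c / real (card (tree (Suc r)))) \<longlonglongrightarrow> 0"
  by (rule real_tendsto_divide_at_top[OF tendsto_const filterlim_compose[OF filterlim_card_tree filterlim_Suc]])

lemma tree_mean_measurable:
  assumes "\<And>i. 1 \<le> i \<Longrightarrow> f i \<in> borel_measurable M"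
  shows "(\<lambda>\<omega>. tree_mean r (\<lambda>i. f i \<omega>)) \<in> borel_measurable M"
  unfolding tree_mean_def using assms
  by (intro borel_measurable_divide borel_measurable_sum borel_measurable_const) (auto simp: tree_def)

section \<open>Noises independent of the past\<close>

lemma integrable_mult_square_integrable:
  fixes f g :: "'a \<Rightarrow> real"
  assumes [measurable]: "f \<in> borel_measurable M" "g \<in> borel_measurable M"
    and "integrable M (\<lambda>x. (f x)\<^sup>2)" "integrable M (\<lambda>x. (g x)\<^sup>2)"
  shows "integrable M (\<lambda>x. f x * g x)"
proof (rule Bochner_Integration.integrable_bound)
  show "integrable M (\<lambda>x. (f x)\<^sup>2 + (g x)\<^sup>2)"
    using assms by simp
  show "AE x in M. norm (f x * g x) \<le> norm ((f x)\<^sup>2 + (g x)\<^sup>2)"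
  proof (rule AE_I2)
    fix x
    have "2 * (\<bar>f x\<bar> * \<bar>g x\<bar>) \<le> (f x)\<^sup>2 + (g x)\<^sup>2"
      using sum_squares_bound[of "\<bar>f x\<bar>" "\<bar>g x\<bar>"] by (simp add: mult.assoc)
    then show "norm (f x * g x) \<le> norm ((f x)\<^sup>2 + (g x)\<^sup>2)"
      using mult_nonneg_nonneg[of "\<bar>f x\<bar>" "\<bar>g x\<bar>"] unfolding real_norm_def abs_mult
      by (smt (verit) abs_ge_zero)
  qed
qed simp

text \<open>\<open>F n\<close> is what is known just before the noise \<open>\<eta> n\<close>, which
  becomes known at \<open>Suc n\<close>. A coefficient of \<open>\<eta> n\<close> may thus be any
  variable measurable in \<open>F n\<close>, which is what allows \<open>X n\<close> itself as a
  coefficient.\<close>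

locale adapted_noise = prob_space M for M :: "'a measure" +
  fixes F :: "nat \<Rightarrow> 'a measure" and \<eta> :: "nat \<Rightarrow> 'a \<Rightarrow> real"
  assumes subalg: "\<And>n. subalgebra M (F n)"
    and subalg_mono: "\<And>m n. m \<le> n \<Longrightarrow> subalgebra (F n) (F m)"
    and noise_adapted: "\<And>n. 1 \<le> n \<Longrightarrow> \<eta> n \<in> borel_measurable (F (Suc n))"
    and noise_indep_past:
      "\<And>n. 1 \<le> n \<Longrightarrow> indep_set (sets (F n)) (sets (vimage_algebra (space M) (\<eta> n) borel))"
begin

lemma measurable_past: "f \<in> measurable (F m) N \<Longrightarrow> m \<le> n \<Longrightarrow> f \<in> measurable (F n) N"
  using measurable_from_subalg[OF subalg_mono] .

lemma measurable_past_M: "f \<in> measurable (F m) N \<Longrightarrow> f \<in> measurable M N"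
  using measurable_from_subalg[OF subalg] .

lemma noise_measurable: "1 \<le> n \<Longrightarrow> \<eta> n \<in> borel_measurable M"
  using measurable_past_M[OF noise_adapted] .

text \<open>Independence passes to smaller sigma-algebras: preimages under \<open>U\<close> lie in
  \<open>F n\<close>, and preimages under a Borel function of the noise lie in the sigma-algebra
  that the noise generates.\<close>

lemma indep_var_past_noise:
  assumes n: "1 \<le> n" and U: "U \<in> measurable (F n) N" and g: "g \<in> measurable borel N'"
  shows "indep_var N U N' (\<lambda>\<omega>. g (\<eta> n \<omega>))"
proof -
  let ?V = "vimage_algebra (space M) (\<eta> n) borel"
  let ?A = "{U -` A \<inter> space M | A. A \<in> sets N}" and ?B = "{(\<lambda>\<omega>. g (\<eta> n \<omega>)) -` A \<inter> space M | A. A \<in> sets N'}"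
  have A: "?A \<subseteq> sets (F n)"
    using measurable_sets[OF U] subalg[of n] by (auto simp: subalgebra_def)
  have "(\<lambda>\<omega>. g (\<eta> n \<omega>)) \<in> measurable ?V N'"
    by (intro measurable_compose[OF _ g] measurable_vimage_algebra1) auto
  from measurable_sets[OF this] have B: "?B \<subseteq> sets ?V"
    by auto
  have "sigma_sets (space M) ?A \<subseteq> sets (F n)"
    using sets.sigma_sets_subset[OF A] subalg[of n] by (simp add: subalgebra_def)
  moreover have "sigma_sets (space M) ?B \<subseteq> sets ?V"
    using sets.sigma_sets_subset[OF B] by simp
  ultimately have "indep_set (sigma_sets (space M) ?A) (sigma_sets (space M) ?B)"
    using noise_indep_past[OF n] unfolding indep_sets2_eq by blast
  then show ?thesis
    unfolding indep_var_eq
    using measurable_past_M[OF U] measurable_compose[OF noise_measurable[OF n] g] by blast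
qed

lemma
  fixes f :: "'a \<Rightarrow> real" and g :: "real \<Rightarrow> real"
  assumes "1 \<le> n" "f \<in> borel_measurable (F n)" "integrable M f"
    and [measurable]: "g \<in> borel_measurable borel" and g: "integrable M (\<lambda>\<omega>. g (\<eta> n \<omega>))"
  shows integrable_past_mult_noise: "integrable M (\<lambda>\<omega>. f \<omega> * g (\<eta> n \<omega>))"
    and expectation_past_mult_noise:
      "expectation (\<lambda>\<omega>. f \<omega> * g (\<eta> n \<omega>)) = expectation f * expectation (\<lambda>\<omega>. g (\<eta> n \<omega>))"
proof -
  have ind: "indep_var borel f borel (\<lambda>\<omega>. g (\<eta> n \<omega>))"
    by (rule indep_var_past_noise) (use assms in auto)
  show "integrable M (\<lambda>\<omega>. f \<omega> * g (\<eta> n \<omega>))"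
    by (rule indep_var_integrable[OF ind]) (use assms in auto)
  show "expectation (\<lambda>\<omega>. f \<omega> * g (\<eta> n \<omega>)) = expectation f * expectation (\<lambda>\<omega>. g (\<eta> n \<omega>))"
    by (rule indep_var_lebesgue_integral[OF ind]) (use assms in auto)
qed

lemma sum_noise_adapted:
  assumes "\<And>k. 1 \<le> k \<Longrightarrow> c k \<in> borel_measurable (F k)"
  shows "(\<lambda>\<omega>. \<Sum>k=1..n. c k \<omega> * \<eta> k \<omega>) \<in> borel_measurable (F (Suc n))"
proof (rule borel_measurable_sum)
  fix k assume "k \<in> {1..n}"
  then have "c k \<in> borel_measurable (F (Suc n))" "\<eta> k \<in> borel_measurable (F (Suc n))"
    using measurable_past[OF assms, of k "Suc n"] measurable_past[OF noise_adapted, of k "Suc n"] by auto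
  then show "(\<lambda>\<omega>. c k \<omega> * \<eta> k \<omega>) \<in> borel_measurable (F (Suc n))"
    by simp
qed

lemma adapted_noise_compose:
  assumes g[measurable]: "g \<in> borel_measurable borel"
  shows "adapted_noise M F (\<lambda>n \<omega>. g (\<eta> n \<omega>))"
proof
  fix n :: nat assume n: "1 \<le> n"
  show "(\<lambda>\<omega>. g (\<eta> n \<omega>)) \<in> borel_measurable (F (Suc n))"
    using noise_adapted[OF n] by simp
  let ?V = "vimage_algebra (space M) (\<eta> n) borel"
  have [measurable]: "\<eta> n \<in> borel_measurable ?V"
    by (rule measurable_vimage_algebra1) auto
  have "(\<lambda>\<omega>. g (\<eta> n \<omega>)) \<in> borel_measurable ?V"
    by measurable
  then have "sets (vimage_algebra (space M) (\<lambda>\<omega>. g (\<eta> n \<omega>)) borel) \<subseteq> sets ?V"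
    by (intro sets_image_in_sets) auto
  then show "indep_set (sets (F n)) (sets (vimage_algebra (space M) (\<lambda>\<omega>. g (\<eta> n \<omega>)) borel))"
    using noise_indep_past[OF n] unfolding indep_sets2_eq by blast
qed (fact subalg subalg_mono)+

end

section \<open>Orthogonal sums of centered noises\<close>

locale centered_noise = adapted_noise M F \<eta> for M :: "'a measure" and F \<eta> +
  fixes v :: real
  assumes noise_mean: "\<And>n. 1 \<le> n \<Longrightarrow> expectation (\<eta> n) = 0"
    and noise_square_integrable: "\<And>n. 1 \<le> n \<Longrightarrow> integrable M (\<lambda>\<omega>. (\<eta> n \<omega>)\<^sup>2)"
    and noise_variance: "\<And>n. 1 \<le> n \<Longrightarrow> expectation (\<lambda>\<omega>. (\<eta> n \<omega>)\<^sup>2) = v"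
begin

lemma noise_integrable: "1 \<le> n \<Longrightarrow> integrable M (\<eta> n)"
  using square_integrable_imp_integrable[OF noise_measurable noise_square_integrable] .

text \<open>In the square of a sum, the cross term is an integrable variable of the past times a
  centered noise independent of it, so its expectation is 0. The \<open>n\<close> diagonal terms
  remain, each at most \<open>C * v\<close> because the squared coefficient is independent of the
  squared noise.\<close>

lemma
  assumes c: "\<And>k. 1 \<le> k \<Longrightarrow> c k \<in> borel_measurable (F k)"
    "\<And>k. 1 \<le> k \<Longrightarrow> integrable M (\<lambda>\<omega>. (c k \<omega>)\<^sup>2)" "\<And>k. 1 \<le> k \<Longrightarrow> expectation (\<lambda>\<omega>. (c k \<omega>)\<^sup>2) \<le> C"
  shows integrable_sum_noise_square: "integrable M (\<lambda>\<omega>. (\<Sum>k=1..n. c k \<omega> * \<eta> k \<omega>)\<^sup>2)"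
    and expectation_sum_noise_square: "expectation (\<lambda>\<omega>. (\<Sum>k=1..n. c k \<omega> * \<eta> k \<omega>)\<^sup>2) \<le> n * C * v"
proof (induction n)
  case (Suc n)
  define S where "S \<omega> = (\<Sum>k=1..n. c k \<omega> * \<eta> k \<omega>)" for \<omega>
  let ?c = "c (Suc n)" and ?e = "\<eta> (Suc n)"
  have sq: "(\<Sum>k=1..Suc n. c k \<omega> * \<eta> k \<omega>)\<^sup>2 =
      (S \<omega>)\<^sup>2 + 2 * (S \<omega> * ?c \<omega> * ?e \<omega>) + (?c \<omega>)\<^sup>2 * (?e \<omega>)\<^sup>2" for \<omega>
    by (simp add: S_def power2_sum power_mult_distrib algebra_simps)
  have Sm[measurable]: "S \<in> borel_measurable (F (Suc n))" "?c \<in> borel_measurable (F (Suc n))"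
    unfolding S_def using sum_noise_adapted[OF c(1)] c(1)[of "Suc n"] by auto
  have Sint: "integrable M (\<lambda>\<omega>. (S \<omega>)\<^sup>2)" and SE: "expectation (\<lambda>\<omega>. (S \<omega>)\<^sup>2) \<le> n * C * v"
    using Suc by (simp_all add: S_def)
  have Sc: "integrable M (\<lambda>\<omega>. S \<omega> * ?c \<omega>)"
    using Sm Sint c(2) by (intro integrable_mult_square_integrable measurable_past_M[of _ "Suc n"]) auto
  have Scm: "(\<lambda>\<omega>. S \<omega> * ?c \<omega>) \<in> borel_measurable (F (Suc n))"
    and c2m: "(\<lambda>\<omega>. (?c \<omega>)\<^sup>2) \<in> borel_measurable (F (Suc n))"
    by measurable
  have n1: "1 \<le> Suc n" by simp
  have i1: "integrable M (\<lambda>\<omega>. S \<omega> * ?c \<omega> * ?e \<omega>)"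
    by (rule integrable_past_mult_noise[OF n1 Scm Sc, of "\<lambda>x. x"]) (simp_all add: noise_integrable)
  have e1: "expectation (\<lambda>\<omega>. S \<omega> * ?c \<omega> * ?e \<omega>) = 0"
    by (subst expectation_past_mult_noise[OF n1 Scm Sc, of "\<lambda>x. x"]) (simp_all add: noise_integrable noise_mean)
  have i2: "integrable M (\<lambda>\<omega>. (?c \<omega>)\<^sup>2 * (?e \<omega>)\<^sup>2)"
    by (rule integrable_past_mult_noise[OF n1 c2m c(2)[OF n1], of "\<lambda>x. x\<^sup>2"])
      (simp_all add: noise_square_integrable)
  have e2: "expectation (\<lambda>\<omega>. (?c \<omega>)\<^sup>2 * (?e \<omega>)\<^sup>2) = expectation (\<lambda>\<omega>. (?c \<omega>)\<^sup>2) * v"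
    by (subst expectation_past_mult_noise[OF n1 c2m c(2)[OF n1], of "\<lambda>x. x\<^sup>2"])
      (simp_all add: noise_square_integrable noise_variance)
  have "0 \<le> v"
    using noise_variance[of 1] integral_nonneg_AE[of "\<lambda>\<omega>. (\<eta> 1 \<omega>)\<^sup>2" M] by simp
  then have "expectation (\<lambda>\<omega>. (?c \<omega>)\<^sup>2) * v \<le> C * v"
    using c(3)[of "Suc n"] by (intro mult_right_mono) auto
  {
    case 1
    show ?case unfolding sq using Sint i1 i2 by simp
  next
    case 2
    have "expectation (\<lambda>\<omega>. (S \<omega>)\<^sup>2 + 2 * (S \<omega> * ?c \<omega> * ?e \<omega>) + (?c \<omega>)\<^sup>2 * (?e \<omega>)\<^sup>2) =
        expectation (\<lambda>\<omega>. (S \<omega>)\<^sup>2) + expectation (\<lambda>\<omega>. (?c \<omega>)\<^sup>2) * v"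
      using Sint i1 i2 e1 e2 by simp
    also have "\<dots> \<le> Suc n * C * v"
      using SE \<open>expectation (\<lambda>\<omega>. (?c \<omega>)\<^sup>2) * v \<le> C * v\<close> by (simp add: algebra_simps)
    finally show ?case unfolding sq .
  }
qed simp_all

text \<open>It is applied to constant coefficients, to the coefficients \<open>X\<close>, and to
  constant coefficients with the centered squares of a Gaussian noise as the noise.\<close>

lemma AE_tree_mean_noise:
  assumes c: "\<And>k. 1 \<le> k \<Longrightarrow> c k \<in> borel_measurable (F k)"
    "\<And>k. 1 \<le> k \<Longrightarrow> integrable M (\<lambda>\<omega>. (c k \<omega>)\<^sup>2)" "\<And>k. 1 \<le> k \<Longrightarrow> expectation (\<lambda>\<omega>. (c k \<omega>)\<^sup>2) \<le> C"
  shows "AE \<omega> in M. (\<lambda>r. tree_mean r (\<lambda>k. c k \<omega> * \<eta> k \<omega>)) \<longlonglongrightarrow> 0"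
proof (rule AE_tendsto_zero_geometric)
  fix r
  define n :: nat where "n = 2 ^ (r + 1) - 1"
  have n: "2 ^ r \<le> n"
    using one_le_power[of "2::nat" r] unfolding n_def by simp
  have sq: "(tree_mean r (\<lambda>k. c k \<omega> * \<eta> k \<omega>))\<^sup>2 = (\<Sum>k=1..n. c k \<omega> * \<eta> k \<omega>)\<^sup>2 / n\<^sup>2" for \<omega>
    by (simp add: tree_mean_def tree_def n_def power_divide)
  show "integrable M (\<lambda>\<omega>. (tree_mean r (\<lambda>k. c k \<omega> * \<eta> k \<omega>))\<^sup>2)"
    unfolding sq using integrable_sum_noise_square[OF c] by simp
  have "0 \<le> v"
    using noise_variance[of 1] integral_nonneg_AE[of "\<lambda>\<omega>. (\<eta> 1 \<omega>)\<^sup>2" M] by simp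
  moreover have "0 \<le> C"
    using c(3)[of 1] integral_nonneg_AE[of "\<lambda>\<omega>. (c 1 \<omega>)\<^sup>2" M] by (meson AE_I2 order_trans order_refl zero_le_power2)
  ultimately have Cv: "0 \<le> C * v" by simp
  have "0 < (2::nat) ^ r" by simp
  then have n0: "0 < n" using n by linarith
  have "expectation (\<lambda>\<omega>. (tree_mean r (\<lambda>k. c k \<omega> * \<eta> k \<omega>))\<^sup>2) \<le> (n * C * v) / n\<^sup>2"
    unfolding sq using expectation_sum_noise_square[OF c, of n] by (simp add: divide_right_mono)
  also have "\<dots> = C * v / n"
    using n0 by (simp add: power2_eq_square)
  also have "\<dots> \<le> C * v / 2 ^ r"
    using n Cv by (intro divide_left_mono) (auto simp: n0 simp flip: of_nat_le_iff)
  also have "\<dots> = C * v * (1 / 2) ^ r"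
    by (simp add: power_one_over)
  finally show "expectation (\<lambda>\<omega>. (tree_mean r (\<lambda>k. c k \<omega> * \<eta> k \<omega>))\<^sup>2) \<le> C * v * (1 / 2) ^ r" .
qed auto

end

section \<open>Sums of conditionally Gaussian increments\<close>

locale gaussian_noise = adapted_noise M F \<eta> for M :: "'a measure" and F \<eta> +
  fixes s :: real
  assumes s_pos: "0 < s"
    and noise_normal: "\<And>n. 1 \<le> n \<Longrightarrow> distributed M lborel (\<eta> n) (normal_density 0 s)"
begin

lemma expectation_iexp_noise:
  assumes n: "1 \<le> n"
  shows "(\<integral>\<omega>. iexp (t * \<eta> n \<omega>) \<partial>M) = of_real (exp (- (t * s)\<^sup>2 / 2))"
proof -
  have D: "distributed M lborel (\<lambda>\<omega>. \<eta> n \<omega> / s) std_normal_density"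
    using noise_normal[OF n] normal_standard_normal_convert[OF s_pos, of "\<eta> n" 0] by simp
  have "distr M borel (\<lambda>\<omega>. \<eta> n \<omega> / s) = density lborel std_normal_density"
    using distributed_distr_eq_density[OF D] by (simp cong: distr_cong)
  then have "char (distr M borel (\<lambda>\<omega>. \<eta> n \<omega> / s)) (t * s) = of_real (exp (- (t * s)\<^sup>2 / 2))"
    by (simp add: char_std_normal_distribution)
  then show ?thesis
    using s_pos noise_measurable[OF n] by (simp add: char_def integral_distr)
qed

text \<open>This is conditioning on \<open>F n\<close>: given the past, \<open>c\<close> and
  \<open>H\<close> are constants and the noise is integrated against its normal law. Independence
  and Fubini on the joint law replace conditional expectations.\<close>

lemma expectation_past_iexp_noise:
  fixes H :: "'a \<Rightarrow> complex"
  assumes n: "1 \<le> n" and c: "c \<in> borel_measurable (F n)" and H: "H \<in> borel_measurable (F n)"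
    and B: "\<And>\<omega>. \<omega> \<in> space M \<Longrightarrow> norm (H \<omega>) \<le> B"
  shows "(\<integral>\<omega>. H \<omega> * iexp (c \<omega> * \<eta> n \<omega>) \<partial>M) = (\<integral>\<omega>. H \<omega> * of_real (exp (- (c \<omega> * s)\<^sup>2 / 2)) \<partial>M)"
proof -
  \<comment> \<open>Both sides of the independence take values in one common space of triples:
    \<open>U\<close> carries the coefficient and the prefactor, \<open>W\<close> carries the noise,
    and the other slots are filled with 0.\<close>
  let ?S = "borel \<Otimes>\<^sub>M borel \<Otimes>\<^sub>M borel :: (real \<times> complex \<times> real) measure"
  define U W where "U \<omega> = (c \<omega>, H \<omega>, 0 :: real)" and "W \<omega> = (0 :: real, 0 :: complex, \<eta> n \<omega>)" for \<omega>
  have UF: "U \<in> measurable (F n) ?S"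
    unfolding U_def using c H by measurable
  have ind: "indep_var ?S U ?S W"
    unfolding W_def using indep_var_past_noise[OF n UF, of "\<lambda>x. (0, 0, x)"] by simp
  note [measurable] = noise_measurable[OF n] measurable_past_M[OF c] measurable_past_M[OF H]
    measurable_past_M[OF UF] indep_var_rv2[OF ind]
  have J: "distr M ?S U \<Otimes>\<^sub>M distr M ?S W = distr M (?S \<Otimes>\<^sub>M ?S) (\<lambda>\<omega>. (U \<omega>, W \<omega>))"
    using ind by (simp add: indep_var_distribution_eq)
  interpret PU: prob_space "distr M ?S U" by (rule prob_space_distr) simp
  interpret PW: prob_space "distr M ?S W" by (rule prob_space_distr) simp
  interpret P: pair_prob_space "distr M ?S U" "distr M ?S W" ..
  let ?f = "\<lambda>(u, w). fst (snd u) * iexp (fst u * snd (snd w))"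
  have f[measurable]: "?f \<in> borel_measurable (?S \<Otimes>\<^sub>M ?S)"
    by measurable
  have "integrable M (\<lambda>\<omega>. H \<omega> * iexp (c \<omega> * \<eta> n \<omega>))"
    by (rule integrable_const_bound[of _ B]) (use B in \<open>auto simp: norm_mult\<close>)
  then have int: "integrable (distr M ?S U \<Otimes>\<^sub>M distr M ?S W) ?f"
    unfolding J by (subst integrable_distr_eq) (auto simp: U_def W_def)
  have "(\<integral>\<omega>. H \<omega> * iexp (c \<omega> * \<eta> n \<omega>) \<partial>M) = integral\<^sup>L (distr M ?S U \<Otimes>\<^sub>M distr M ?S W) ?f"
    unfolding J by (subst integral_distr) (auto simp: U_def W_def)
  also have "\<dots> = (\<integral>u. \<integral>w. fst (snd u) * iexp (fst u * snd (snd w)) \<partial>distr M ?S W \<partial>distr M ?S U)"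
    using P.integral_fst'[OF int] by simp
  also have "\<dots> = (\<integral>u. fst (snd u) * of_real (exp (- (fst u * s)\<^sup>2 / 2)) \<partial>distr M ?S U)"
    using expectation_iexp_noise[OF n]
    by (intro Bochner_Integration.integral_cong refl) (simp add: integral_distr W_def)
  also have "\<dots> = (\<integral>\<omega>. H \<omega> * of_real (exp (- (c \<omega> * s)\<^sup>2 / 2)) \<partial>M)"
    by (subst integral_distr) (auto simp: U_def)
  finally show ?thesis .
qed

text \<open>Integrating out the last noise given the past produces
  \<open>exp (- (c n \<omega> * s)\<^sup>2 / 2)\<close>, which cancels the last term of the
  exponential weight exactly; induction removes the increments one by one. The bound
  \<open>C\<close> keeps the weight bounded.\<close>

lemma expectation_exponential_martingale:
  assumes c: "\<And>k. 1 \<le> k \<Longrightarrow> c k \<in> borel_measurable (F k)"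
    and C: "\<And>\<omega>. \<omega> \<in> space M \<Longrightarrow> (\<Sum>k=1..n. (c k \<omega> * s)\<^sup>2) \<le> C"
  shows "(\<integral>\<omega>. iexp (\<Sum>k=1..n. c k \<omega> * \<eta> k \<omega>) * of_real (exp ((\<Sum>k=1..n. (c k \<omega> * s)\<^sup>2) / 2)) \<partial>M) = 1"
  using C
proof (induction n)
  case 0
  then show ?case by (simp add: prob_space)
next
  case (Suc n)
  define S A where "S \<omega> = (\<Sum>k=1..n. c k \<omega> * \<eta> k \<omega>)" and "A \<omega> = (\<Sum>k=1..Suc n. (c k \<omega> * s)\<^sup>2)" for \<omega>
  have A: "A \<omega> = (\<Sum>k=1..n. (c k \<omega> * s)\<^sup>2) + (c (Suc n) \<omega> * s)\<^sup>2" for \<omega>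
    by (simp add: A_def)
  have S_meas[measurable]: "S \<in> borel_measurable (F (Suc n))"
    unfolding S_def using sum_noise_adapted[OF c] .
  \<comment> \<open>The weight is predictable: its last term already belongs to
    \<open>F (Suc n)\<close>, before \<open>\<eta> (Suc n)\<close> is known, so the whole weight can
    be part of the prefactor \<open>H\<close>.\<close>
  have A_meas[measurable]: "A \<in> borel_measurable (F (Suc n))"
    unfolding A_def
  proof (rule borel_measurable_sum)
    fix k assume "k \<in> {1..Suc n}"
    then have "c k \<in> borel_measurable (F (Suc n))"
      using measurable_past[OF c, of k "Suc n"] by auto
    then show "(\<lambda>\<omega>. (c k \<omega> * s)\<^sup>2) \<in> borel_measurable (F (Suc n))" by simp
  qed
  have "(\<integral>\<omega>. iexp (\<Sum>k=1..Suc n. c k \<omega> * \<eta> k \<omega>) * of_real (exp (A \<omega> / 2)) \<partial>M)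
    = (\<integral>\<omega>. (iexp (S \<omega>) * of_real (exp (A \<omega> / 2))) * iexp (c (Suc n) \<omega> * \<eta> (Suc n) \<omega>) \<partial>M)"
    by (simp add: S_def algebra_simps exp_add)
  also have "\<dots> = (\<integral>\<omega>. (iexp (S \<omega>) * of_real (exp (A \<omega> / 2))) * of_real (exp (- (c (Suc n) \<omega> * s)\<^sup>2 / 2)) \<partial>M)"
  proof (rule expectation_past_iexp_noise)
    show "norm (iexp (S \<omega>) * of_real (exp (A \<omega> / 2))) \<le> exp (C / 2)" if "\<omega> \<in> space M" for \<omega>
      using Suc.prems[OF that] by (simp add: norm_mult A_def)
  qed (use c in auto)
  also have "\<dots> = (\<integral>\<omega>. iexp (S \<omega>) * of_real (exp ((\<Sum>k=1..n. (c k \<omega> * s)\<^sup>2) / 2)) \<partial>M)"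
    by (intro Bochner_Integration.integral_cong refl)
      (simp add: A mult.assoc flip: of_real_mult exp_add, simp add: field_simps)
  also have "\<dots> = 1"
    unfolding S_def
  proof (rule Suc.IH)
    show "(\<Sum>k=1..n. (c k \<omega> * s)\<^sup>2) \<le> C" if "\<omega> \<in> space M" for \<omega>
    proof -
      have "(\<Sum>k=1..n. (c k \<omega> * s)\<^sup>2) \<le> (\<Sum>k=1..Suc n. (c k \<omega> * s)\<^sup>2)"
        by simp
      then show ?thesis using Suc.prems[OF that] by (rule order_trans)
    qed
  qed
  finally show ?case by (simp add: A_def)
qed

text \<open>As the increments are conditionally Gaussian, \<open>exp (i S + A / 2)\<close> has expectation exactly
  \<open>1\<close>, where \<open>S\<close> is the sum and \<open>A\<close> its conditional variance, once \<open>A\<close> is bounded; the increments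
  are therefore stopped when \<open>A\<close> exceeds \<open>\<bar>V\<bar> + 1\<close>, which almost surely changes nothing in the
  end.\<close>

lemma char_noise_sum_tendsto:
  assumes c: "\<And>r k. 1 \<le> k \<Longrightarrow> c r k \<in> borel_measurable (F k)"
    and A: "AE \<omega> in M. (\<lambda>r. \<Sum>k=1..n r. (c r k \<omega> * s)\<^sup>2) \<longlonglongrightarrow> V"
  shows "(\<lambda>r. \<integral>\<omega>. iexp (\<Sum>k=1..n r. c r k \<omega> * \<eta> k \<omega>) \<partial>M) \<longlonglongrightarrow> of_real (exp (- V / 2))"
proof -
  \<comment> \<open>The level lies strictly above \<open>V\<close>, so that stopping eventually
    ceases to matter, and it is nonnegative, so that the empty sum obeys the bound.\<close>
  define C where "C = \<bar>V\<bar> + 1"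
  define A where "A r j \<omega> = (\<Sum>k=1..j. (c r k \<omega> * s)\<^sup>2)" for r j \<omega>
  \<comment> \<open>The test includes the term \<open>k\<close> itself, which is allowed because
    \<open>c r k\<close> is measurable in \<open>F k\<close>. Hence the stopped variance never
    overshoots \<open>C\<close>; as \<open>A r\<close> is nondecreasing, every increment after the
    first rejected one is rejected as well.\<close>
  define d where "d r k \<omega> = (if A r k \<omega> \<le> C then c r k \<omega> else 0)" for r k \<omega>
  define A' where "A' r j \<omega> = (\<Sum>k=1..j. (d r k \<omega> * s)\<^sup>2)" for r j \<omega>
  have Am: "A r j \<in> borel_measurable (F j)" for r j
    unfolding A_def
  proof (rule borel_measurable_sum)
    fix k assume "k \<in> {1..j}"
    then have "c r k \<in> borel_measurable (F j)"
      using measurable_past[OF c, of k j] by auto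
    then show "(\<lambda>\<omega>. (c r k \<omega> * s)\<^sup>2) \<in> borel_measurable (F j)" by simp
  qed
  have dm: "d r k \<in> borel_measurable (F k)" if "1 \<le> k" for r k
    unfolding d_def[abs_def] using Am[of r k] c[OF that, of r] by measurable
  have A_mono: "A r i \<omega> \<le> A r j \<omega>" if "i \<le> j" for r i j \<omega>
    unfolding A_def using that by (intro sum_mono2) auto
  have A'_le: "A' r j \<omega> \<le> C" for r j \<omega>
  proof (induction j)
    case (Suc j)
    show ?case
    proof (cases "A r (Suc j) \<omega> \<le> C")
      case True
      have "A' r (Suc j) \<omega> = A r (Suc j) \<omega>"
        unfolding A_def A'_def
        using order_trans[OF A_mono True] by (intro sum.cong) (auto simp: d_def)
      then show ?thesis using True by simp
    next
      case False
      then show ?thesis using Suc by (simp add: A'_def d_def)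
    qed
  qed (simp add: A'_def C_def)
  note dM = measurable_past_M[OF dm] and cM = measurable_past_M[OF c]
  define E where "E r \<omega> = iexp (\<Sum>k=1..n r. d r k \<omega> * \<eta> k \<omega>) * of_real (exp (A' r (n r) \<omega> / 2))" for r \<omega>
  have sumd: "(\<lambda>\<omega>. \<Sum>k=1..n r. d r k \<omega> * \<eta> k \<omega>) \<in> borel_measurable M" for r
    by (intro measurable_past_M[OF sum_noise_adapted] dm)
  have sumc: "(\<lambda>\<omega>. \<Sum>k=1..n r. c r k \<omega> * \<eta> k \<omega>) \<in> borel_measurable M" for r
    by (intro measurable_past_M[OF sum_noise_adapted] c)
  have A'm: "(\<lambda>\<omega>. A' r (n r) \<omega>) \<in> borel_measurable M" for r
    unfolding A'_def using dM by (intro borel_measurable_sum) auto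
  have Em: "E r \<in> borel_measurable M" for r
    unfolding E_def[abs_def] using sumd A'm by measurable
  have En: "norm (E r \<omega>) \<le> exp (C / 2)" for r \<omega>
    using A'_le[of r "n r" \<omega>] by (simp add: E_def norm_mult)
  have Eint: "integrable M (E r)" for r
    using En Em by (intro integrable_const_bound[of _ "exp (C / 2)"]) auto
  have E1: "integral\<^sup>L M (E r) = 1" for r
    unfolding E_def A'_def
    by (rule expectation_exponential_martingale[OF dm]) (use A'_le in \<open>auto simp: A'_def\<close>)
  have cint: "integrable M (\<lambda>\<omega>. iexp (\<Sum>k=1..n r. c r k \<omega> * \<eta> k \<omega>))" for r
    by (rule integrable_iexp) (use sumc in \<open>auto simp del: of_real_sum\<close>)
  \<comment> \<open>Since \<open>E r\<close> has expectation 1, it suffices to compare with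
    \<open>exp (- V / 2) * E r\<close>. The oscillating factor need not converge, but it has modulus
    1 and eventually multiplies \<open>1 - exp ((A r (n r) \<omega> - V) / 2)\<close>, which
    vanishes.\<close>
  have "(\<lambda>r. \<integral>\<omega>. iexp (\<Sum>k=1..n r. c r k \<omega> * \<eta> k \<omega>) - of_real (exp (- V / 2)) * E r \<omega> \<partial>M)
      \<longlonglongrightarrow> (\<integral>\<omega>. 0 \<partial>M)"
  proof (rule integral_dominated_convergence)
    show "AE \<omega> in M. (\<lambda>r. iexp (\<Sum>k=1..n r. c r k \<omega> * \<eta> k \<omega>) - of_real (exp (- V / 2)) * E r \<omega>) \<longlonglongrightarrow> 0"
      using A
    proof eventually_elim
      fix \<omega> assume "(\<lambda>r. \<Sum>k=1..n r. (c r k \<omega> * s)\<^sup>2) \<longlonglongrightarrow> V"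
      then have lim: "(\<lambda>r. A r (n r) \<omega>) \<longlonglongrightarrow> V"
        by (simp add: A_def)
      then have "eventually (\<lambda>r. A r (n r) \<omega> < C) sequentially"
        by (rule order_tendstoD(2)) (simp add: C_def)
      then have eq: "eventually (\<lambda>r. iexp (\<Sum>k=1..n r. c r k \<omega> * \<eta> k \<omega>) *
            of_real (1 - exp ((A r (n r) \<omega> - V) / 2)) =
          iexp (\<Sum>k=1..n r. c r k \<omega> * \<eta> k \<omega>) - of_real (exp (- V / 2)) * E r \<omega>) sequentially"
      proof eventually_elim
        fix r assume "A r (n r) \<omega> < C"
        then have "d r k \<omega> = c r k \<omega>" if "k \<in> {1..n r}" for k
          using A_mono[of k "n r" r \<omega>] that by (simp add: d_def)
        then have "(\<Sum>k=1..n r. d r k \<omega> * \<eta> k \<omega>) = (\<Sum>k=1..n r. c r k \<omega> * \<eta> k \<omega>)"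
          and "A' r (n r) \<omega> = A r (n r) \<omega>"
          by (simp_all add: A_def A'_def)
        moreover have "complex_of_real (exp ((A r (n r) \<omega> - V) / 2)) =
            of_real (exp (- V / 2)) * of_real (exp (A r (n r) \<omega> / 2))"
          by (simp add: diff_divide_distrib flip: exp_add of_real_mult)
        ultimately show "iexp (\<Sum>k=1..n r. c r k \<omega> * \<eta> k \<omega>) *
            of_real (1 - exp ((A r (n r) \<omega> - V) / 2)) =
          iexp (\<Sum>k=1..n r. c r k \<omega> * \<eta> k \<omega>) - of_real (exp (- V / 2)) * E r \<omega>"
          unfolding E_def
          by (simp only: of_real_diff of_real_1 right_diff_distrib mult_1_right mult.left_commute)
      qed
      have "(\<lambda>r. 1 - exp ((A r (n r) \<omega> - V) / 2)) \<longlonglongrightarrow> 1 - exp ((V - V) / 2)"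
        by (intro tendsto_intros lim) auto
      then have "(\<lambda>r. iexp (\<Sum>k=1..n r. c r k \<omega> * \<eta> k \<omega>) *
          of_real (1 - exp ((A r (n r) \<omega> - V) / 2))) \<longlonglongrightarrow> 0"
        by (subst tendsto_norm_zero_iff[symmetric]) (simp add: norm_mult tendsto_rabs_zero_iff del: of_real_diff)
      then show "(\<lambda>r. iexp (\<Sum>k=1..n r. c r k \<omega> * \<eta> k \<omega>) - of_real (exp (- V / 2)) * E r \<omega>) \<longlonglongrightarrow> 0"
        using Lim_transform_eventually[OF _ eq] by blast
    qed
    show "AE \<omega> in M. norm (iexp (\<Sum>k=1..n r. c r k \<omega> * \<eta> k \<omega>) - of_real (exp (- V / 2)) * E r \<omega>)
        \<le> 1 + exp (- V / 2) * exp (C / 2)" for r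
    proof (rule AE_I2)
      fix \<omega>
      show "norm (iexp (\<Sum>k=1..n r. c r k \<omega> * \<eta> k \<omega>) - of_real (exp (- V / 2)) * E r \<omega>)
          \<le> 1 + exp (- V / 2) * exp (C / 2)"
        using En[of r \<omega>]
        by (intro order_trans[OF norm_triangle_ineq4] add_mono) (auto simp: norm_mult intro!: mult_left_mono simp del: of_real_sum)
    qed
  qed (use sumc Em in measurable)
  then have "(\<lambda>r. (\<integral>\<omega>. iexp (\<Sum>k=1..n r. c r k \<omega> * \<eta> k \<omega>) \<partial>M) - of_real (exp (- V / 2))) \<longlonglongrightarrow> 0"
    using cint Eint E1 by simp
  then show ?thesis
    by (simp only: LIM_zero_iff)
qed

section \<open>Moments of the Gaussian noise\<close>

lemma
  assumes n: "1 \<le> n"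
  shows noise_moment_integrable: "integrable M (\<lambda>\<omega>. \<eta> n \<omega> ^ k)"
    and noise_moment: "expectation (\<lambda>\<omega>. \<eta> n \<omega> ^ k) = (\<integral>x. normal_density 0 s x * x ^ k \<partial>lborel)"
  using integrable_normal_moment[OF s_pos, of 0 k]
    distributed_integrable[OF noise_normal[OF n], of "\<lambda>x. x ^ k"]
    distributed_integral[OF noise_normal[OF n], of "\<lambda>x. x ^ k"] by (auto simp: normal_density_nonneg)

lemma
  assumes n: "1 \<le> n"
  shows noise_moment_1: "expectation (\<eta> n) = 0"
    and noise_moment_2: "expectation (\<lambda>\<omega>. (\<eta> n \<omega>)\<^sup>2) = s\<^sup>2"
    and noise_moment_4: "expectation (\<lambda>\<omega>. \<eta> n \<omega> ^ 4) = 3 * s ^ 4"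
proof -
  show "expectation (\<eta> n) = 0"
    using noise_moment[OF n, of 1] integral_normal_moment_odd[OF s_pos, of 0 0] by simp
  show "expectation (\<lambda>\<omega>. (\<eta> n \<omega>)\<^sup>2) = s\<^sup>2"
    using noise_moment[OF n, of 2] integral_normal_moment_even[OF s_pos, of 0 1] by (simp add: fact_numeral)
  show "expectation (\<lambda>\<omega>. \<eta> n \<omega> ^ 4) = 3 * s ^ 4"
    using noise_moment[OF n, of 4] integral_normal_moment_even[OF s_pos, of 0 2]
    by (simp add: fact_numeral power_divide flip: power_mult)
qed

lemma centered_noise: "centered_noise M F \<eta> (s\<^sup>2)"
  by unfold_locales (auto simp: noise_moment_1 noise_moment_2 noise_moment_integrable)

text \<open>The variance is \<open>3 * s ^ 4 - s ^ 4\<close>, from the fourth and second normal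
  moments. Centered squares being again a centered noise, the orthogonality argument also yields the
  law of large numbers for squares.\<close>

lemma centered_noise_square: "centered_noise M F (\<lambda>n \<omega>. (\<eta> n \<omega>)\<^sup>2 - s\<^sup>2) (2 * s ^ 4)"
proof -
  interpret sq: adapted_noise M F "\<lambda>n \<omega>. (\<eta> n \<omega>)\<^sup>2 - s\<^sup>2"
    by (rule adapted_noise_compose) simp
  show ?thesis
  proof
    fix n :: nat assume n: "1 \<le> n"
    note int = noise_moment_integrable[OF n]
    have eq: "((\<eta> n \<omega>)\<^sup>2 - s\<^sup>2)\<^sup>2 = \<eta> n \<omega> ^ 4 - 2 * s\<^sup>2 * (\<eta> n \<omega>)\<^sup>2 + s ^ 4" for \<omega>
      by (simp add: power2_eq_square power4_eq_xxxx algebra_simps)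
    show "expectation (\<lambda>\<omega>. (\<eta> n \<omega>)\<^sup>2 - s\<^sup>2) = 0"
      using int[of 2] by (simp add: noise_moment_2[OF n] prob_space)
    show "integrable M (\<lambda>\<omega>. ((\<eta> n \<omega>)\<^sup>2 - s\<^sup>2)\<^sup>2)"
      unfolding eq using int[of 2] int[of 4] by simp
    show "expectation (\<lambda>\<omega>. ((\<eta> n \<omega>)\<^sup>2 - s\<^sup>2)\<^sup>2) = 2 * s ^ 4"
      unfolding eq using int[of 2] int[of 4]
      by (simp add: noise_moment_2[OF n] noise_moment_4[OF n] prob_space flip: power_add)
  qed
qed

lemma AE_tree_mean_square: "AE \<omega> in M. (\<lambda>r. tree_mean r (\<lambda>k. (\<eta> k \<omega>)\<^sup>2)) \<longlonglongrightarrow> s\<^sup>2"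
proof -
  interpret sq: centered_noise M F "\<lambda>n \<omega>. (\<eta> n \<omega>)\<^sup>2 - s\<^sup>2" "2 * s ^ 4"
    by (rule centered_noise_square)
  have "AE \<omega> in M. (\<lambda>r. tree_mean r (\<lambda>k. 1 * ((\<eta> k \<omega>)\<^sup>2 - s\<^sup>2))) \<longlonglongrightarrow> 0"
    by (rule sq.AE_tree_mean_noise[where c = "\<lambda>_ _. 1" and C = 1]) (auto simp: prob_space)
  then show ?thesis
    by eventually_elim (simp add: tree_mean_diff tree_mean_const LIM_zero_iff)
qed

end

section \<open>Convergence of the estimators along a path\<close>

text \<open>The two types of daughters are indexed by \<open>k < 2\<close>, so that one proof serves
  both.\<close>

locale bar_param =
  fixes a b :: "nat \<Rightarrow> real" and s2 :: real
  assumes a: "\<And>k. k < 2 \<Longrightarrow> \<bar>a k\<bar> < 1" and s2: "0 < s2"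
begin

definition "\<theta> = (a 0, b 0, a 1, b 1)"
definition "m1 = \<mu>1 \<theta>"
definition "m2 = \<mu>2 \<theta> s2"
definition "var = m2 - m1\<^sup>2"

lemma a_bounds: "\<bar>a 0\<bar> < 1" "\<bar>a 1\<bar> < 1" "\<bar>(a 0 + a 1) / 2\<bar> < 1" "\<bar>((a 0)\<^sup>2 + (a 1)\<^sup>2) / 2\<bar> < 1"
proof -
  show "\<bar>a 0\<bar> < 1" "\<bar>a 1\<bar> < 1" using a by auto
  then show "\<bar>(a 0 + a 1) / 2\<bar> < 1" by (simp add: abs_less_iff)
  have "(a 0)\<^sup>2 < 1" "(a 1)\<^sup>2 < 1"
    using \<open>\<bar>a 0\<bar> < 1\<close> \<open>\<bar>a 1\<bar> < 1\<close> by (simp_all add: abs_square_less_1)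
  then show "\<bar>((a 0)\<^sup>2 + (a 1)\<^sup>2) / 2\<bar> < 1" by simp
qed

lemma m1_eq: "m1 = ((b 0 + b 1) / 2) / (1 - (a 0 + a 1) / 2)"
  by (simp add: m1_def \<theta>_def)

lemma m2_eq:
  "m2 = (2 * ((a 0 * b 0 + a 1 * b 1) / 2) * m1 + ((b 0)\<^sup>2 + (b 1)\<^sup>2) / 2 + s2) / (1 - ((a 0)\<^sup>2 + (a 1)\<^sup>2) / 2)"
  unfolding m2_def \<theta>_def m1_eq by (simp add: Let_def)

text \<open>\<open>p\<close> and \<open>q\<close> are the expected values of the daughters of an
  individual with value \<open>m1\<close>, and \<open>m1\<close> is their average. By convexity
  \<open>m1\<^sup>2\<close> is at most the average of \<open>p\<^sup>2\<close> and
  \<open>q\<^sup>2\<close>; compared with the equation of \<open>m2\<close>, this leaves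
  \<open>s2 \<le> (1 - ?a2) * var\<close>. As \<open>var\<close> is the limit of the denominators of
  \<open>alpha_hat\<close>, its positivity makes the default values of quotients harmless for large
  \<open>r\<close>.\<close>

lemma var_pos: "0 < var"
proof -
  let ?a2 = "((a 0)\<^sup>2 + (a 1)\<^sup>2) / 2"
  define p q where "p = a 0 * m1 + b 0" and "q = a 1 * m1 + b 1"
  have "m1 * (1 - (a 0 + a 1) / 2) = (b 0 + b 1) / 2"
    using a_bounds(3) by (intro nonzero_eq_divide_eq[THEN iffD1, OF _ m1_eq]) auto
  then have "m1 = (p + q) / 2"
    by (simp add: p_def q_def field_simps)
  moreover have "((p + q) / 2)\<^sup>2 + ((p - q) / 2)\<^sup>2 = (p\<^sup>2 + q\<^sup>2) / 2"
    by (simp add: power2_eq_square field_simps)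
  ultimately have "m1\<^sup>2 + ((p - q) / 2)\<^sup>2 = (p\<^sup>2 + q\<^sup>2) / 2"
    by (simp only:)
  then have "m1\<^sup>2 \<le> (p\<^sup>2 + q\<^sup>2) / 2"
    using zero_le_power2[of "(p - q) / 2"] by linarith
  also have "\<dots> = ?a2 * m1\<^sup>2 + (2 * ((a 0 * b 0 + a 1 * b 1) / 2) * m1 + ((b 0)\<^sup>2 + (b 1)\<^sup>2) / 2)"
    by (simp add: p_def q_def power2_eq_square field_simps)
  also have "\<dots> = ?a2 * m1\<^sup>2 + m2 * (1 - ?a2) - s2"
    using a_bounds(4) by (simp add: m2_eq)
  finally have "s2 \<le> (m2 - m1\<^sup>2) * (1 - ?a2)"
    by (simp only: left_diff_distrib right_diff_distrib mult_1_right) (simp only: mult.commute algebra_simps)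
  then have "(1 - ?a2) * var \<ge> s2"
    by (simp only: var_def mult.commute)
  then have "0 < (1 - ?a2) * var" using s2 by simp
  then show ?thesis using a_bounds(4) by (simp add: zero_less_mult_iff)
qed

end

text \<open>These are the properties that almost every path has. All that is derived from them is
  deterministic, so a single exceptional null set serves all estimators.\<close>

locale bar_path = bar_param a b s2 for a b :: "nat \<Rightarrow> real" and s2 :: real +
  fixes \<rho> :: real and x e :: "nat \<Rightarrow> real"
  assumes \<rho>: "\<rho> < 1"
    and daughter: "\<And>n k. 1 \<le> n \<Longrightarrow> k < 2 \<Longrightarrow> x (2 * n + k) = a k * x n + b k + e (2 * n + k)"
    and mean_noise: "\<And>k. k < 2 \<Longrightarrow> (\<lambda>r. tree_mean r (\<lambda>i. e (2 * i + k))) \<longlonglongrightarrow> 0"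
    and mean_x_noise: "\<And>k. k < 2 \<Longrightarrow> (\<lambda>r. tree_mean r (\<lambda>i. x i * e (2 * i + k))) \<longlonglongrightarrow> 0"
    and mean_noise_square: "\<And>k. k < 2 \<Longrightarrow> (\<lambda>r. tree_mean r (\<lambda>i. (e (2 * i + k))\<^sup>2)) \<longlonglongrightarrow> s2"
    and mean_noise_mult: "(\<lambda>r. tree_mean r (\<lambda>i. e (2 * i) * e (2 * i + 1))) \<longlonglongrightarrow> s2 * \<rho>"
begin

lemma tree_mean_daughter:
  assumes "k < 2"
  shows "tree_mean r (\<lambda>i. x (2 * i + k)) = a k * tree_mean r x + b k + tree_mean r (\<lambda>i. e (2 * i + k))"
proof -
  have "tree_mean r (\<lambda>i. x (2 * i + k)) = tree_mean r (\<lambda>i. a k * x i + b k + e (2 * i + k))"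
    by (rule tree_mean_cong) (use daughter assms in auto)
  then show ?thesis by (simp add: tree_mean_add tree_mean_cmult tree_mean_const)
qed

lemma tree_mean_daughter_square:
  assumes "k < 2"
  shows "tree_mean r (\<lambda>i. (x (2 * i + k))\<^sup>2) = (a k)\<^sup>2 * tree_mean r (\<lambda>i. (x i)\<^sup>2) + 2 * a k * b k * tree_mean r x
    + (b k)\<^sup>2 + tree_mean r (\<lambda>i. (e (2 * i + k))\<^sup>2) + 2 * a k * tree_mean r (\<lambda>i. x i * e (2 * i + k))
    + 2 * b k * tree_mean r (\<lambda>i. e (2 * i + k))"
proof -
  have "tree_mean r (\<lambda>i. (x (2 * i + k))\<^sup>2) = tree_mean r (\<lambda>i. (a k)\<^sup>2 * (x i)\<^sup>2 + 2 * a k * b k * x i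
    + (b k)\<^sup>2 + (e (2 * i + k))\<^sup>2 + 2 * a k * (x i * e (2 * i + k)) + 2 * b k * e (2 * i + k))"
    by (rule tree_mean_cong) (use daughter assms in \<open>simp add: power2_eq_square algebra_simps\<close>)
  then show ?thesis by (simp add: tree_mean_add tree_mean_cmult tree_mean_const)
qed

lemma tree_mean_mult_daughter:
  assumes "k < 2"
  shows "tree_mean r (\<lambda>i. x i * x (2 * i + k)) =
    a k * tree_mean r (\<lambda>i. (x i)\<^sup>2) + b k * tree_mean r x + tree_mean r (\<lambda>i. x i * e (2 * i + k))"
proof -
  have "tree_mean r (\<lambda>i. x i * x (2 * i + k)) =
      tree_mean r (\<lambda>i. a k * (x i)\<^sup>2 + b k * x i + x i * e (2 * i + k))"
    by (rule tree_mean_cong) (use daughter assms in \<open>simp add: power2_eq_square algebra_simps\<close>)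
  then show ?thesis by (simp add: tree_mean_add tree_mean_cmult)
qed

lemma mean_tendsto: "(\<lambda>r. tree_mean r x) \<longlonglongrightarrow> m1"
proof -
  let ?q = "\<lambda>r. real (card (tree r)) / card (tree (Suc r))"
  have "(\<lambda>r. tree_mean r x) \<longlonglongrightarrow> (0 + 1 / 2 * (b 0 + b 1 + 0 + 0)) / (1 - 1 / 2 * (a 0 + a 1))"
  proof (rule contraction_tendsto)
    show "tree_mean (Suc r) x = ?q r * (a 0 + a 1) * tree_mean r x + (x 1 / card (tree (Suc r)) + ?q r *
        (b 0 + b 1 + tree_mean r (\<lambda>i. e (2 * i + 0)) + tree_mean r (\<lambda>i. e (2 * i + 1))))" for r
      using tree_mean_daughter[of 0 r] tree_mean_daughter[of 1 r]
      by (simp add: tree_mean_Suc ring_distribs add_divide_distrib)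
    show "(\<lambda>r. ?q r * (a 0 + a 1)) \<longlonglongrightarrow> 1 / 2 * (a 0 + a 1)"
      by (intro tendsto_intros card_tree_ratio)
    show "(\<lambda>r. x 1 / card (tree (Suc r)) + ?q r *
        (b 0 + b 1 + tree_mean r (\<lambda>i. e (2 * i + 0)) + tree_mean r (\<lambda>i. e (2 * i + 1))))
        \<longlonglongrightarrow> 0 + 1 / 2 * (b 0 + b 1 + 0 + 0)"
      by (intro tendsto_add tendsto_mult tendsto_const card_tree_ratio inverse_card_tendsto mean_noise) auto
  qed (use a_bounds(3) in simp)
  then show ?thesis by (simp add: m1_eq)
qed

text \<open>Squaring the daughter equation puts the mean of \<open>x\<close> into the additive part
  of the recursion, so this limit rests on \<open>mean_tendsto\<close>; the cross terms with the
  noise vanish.\<close>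

lemma mean_square_tendsto: "(\<lambda>r. tree_mean r (\<lambda>i. (x i)\<^sup>2)) \<longlonglongrightarrow> m2"
proof -
  let ?q = "\<lambda>r. real (card (tree r)) / card (tree (Suc r))"
  let ?t = "\<lambda>k r. 2 * a k * b k * tree_mean r x + (b k)\<^sup>2 + tree_mean r (\<lambda>i. (e (2 * i + k))\<^sup>2)
      + 2 * a k * tree_mean r (\<lambda>i. x i * e (2 * i + k)) + 2 * b k * tree_mean r (\<lambda>i. e (2 * i + k))"
  let ?l = "\<lambda>k. 2 * a k * b k * m1 + (b k)\<^sup>2 + s2 + 2 * a k * 0 + 2 * b k * 0"
  have "(\<lambda>r. tree_mean r (\<lambda>i. (x i)\<^sup>2)) \<longlonglongrightarrow>
      (0 + 1 / 2 * (?l 0 + ?l 1)) / (1 - 1 / 2 * ((a 0)\<^sup>2 + (a 1)\<^sup>2))"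
  proof (rule contraction_tendsto)
    show "tree_mean (Suc r) (\<lambda>i. (x i)\<^sup>2) = ?q r * ((a 0)\<^sup>2 + (a 1)\<^sup>2) * tree_mean r (\<lambda>i. (x i)\<^sup>2) +
        ((x 1)\<^sup>2 / card (tree (Suc r)) + ?q r * (?t 0 r + ?t 1 r))" for r
      unfolding tree_mean_Suc
      using tree_mean_daughter_square[of 0 r] tree_mean_daughter_square[of 1 r]
      by (simp add: ring_distribs add_divide_distrib)
    show "(\<lambda>r. ?q r * ((a 0)\<^sup>2 + (a 1)\<^sup>2)) \<longlonglongrightarrow> 1 / 2 * ((a 0)\<^sup>2 + (a 1)\<^sup>2)"
      by (intro tendsto_intros card_tree_ratio)
    show "(\<lambda>r. (x 1)\<^sup>2 / card (tree (Suc r)) + ?q r * (?t 0 r + ?t 1 r))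
        \<longlonglongrightarrow> 0 + 1 / 2 * (?l 0 + ?l 1)"
      by (intro tendsto_add tendsto_mult tendsto_const card_tree_ratio inverse_card_tendsto
          mean_noise mean_tendsto mean_noise_square mean_x_noise) auto
  qed (use a_bounds(4) in simp)
  moreover have "(0 + 1 / 2 * (?l 0 + ?l 1)) / (1 - 1 / 2 * ((a 0)\<^sup>2 + (a 1)\<^sup>2)) = m2"
    unfolding m2_eq by (rule arg_cong2[where f = "(/)"]) (simp_all add: field_simps)
  ultimately show ?thesis by simp
qed

lemma empirical_var_tendsto: "(\<lambda>r. tree_mean r (\<lambda>i. (x i)\<^sup>2) - (tree_mean r x)\<^sup>2) \<longlonglongrightarrow> var"
  unfolding var_def by (intro tendsto_intros mean_tendsto mean_square_tendsto)

text \<open>By the daughter equations the numerator is \<open>a k\<close> times the empirical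
  variance, up to noise terms that vanish.\<close>

lemma alpha_hat_tendsto:
  assumes k: "k < 2"
  shows "(\<lambda>r. alpha_hat k r x) \<longlonglongrightarrow> a k"
proof -
  have "(\<lambda>r. alpha_hat k r x) \<longlonglongrightarrow> ((a k * m2 + b k * m1 + 0) - m1 * (a k * m1 + b k + 0)) / var"
    unfolding alpha_hat_def tree_mean_daughter[OF k] tree_mean_mult_daughter[OF k]
    by (intro tendsto_intros mean_tendsto mean_square_tendsto mean_noise mean_x_noise k empirical_var_tendsto)
      (use var_pos in auto)
  moreover have "(a k * m2 + b k * m1 + 0) - m1 * (a k * m1 + b k + 0) = a k * var"
    by (simp add: var_def power2_eq_square algebra_simps)
  ultimately show ?thesis using var_pos by simp
qed

lemma beta_hat_tendsto:
  assumes k: "k < 2"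
  shows "(\<lambda>r. beta_hat k r x) \<longlonglongrightarrow> b k"
proof -
  have "(\<lambda>r. beta_hat k r x) \<longlonglongrightarrow> (a k * m1 + b k + 0) - a k * m1"
    unfolding beta_hat_def tree_mean_daughter[OF k]
    by (intro tendsto_intros mean_tendsto mean_noise alpha_hat_tendsto k)
  then show ?thesis by simp
qed

text \<open>A residue is the noise plus an affine function of the mother whose coefficients are the
  estimation errors. In the product of two residues every term other than the product of the noises
  carries such a vanishing error in front of a convergent mean. Equal indices serve the variance,
  distinct ones the correlation.\<close>

lemma mean_residue_mult_tendsto:
  assumes k: "k < 2" and l: "l < 2"
    and lim: "(\<lambda>r. tree_mean r (\<lambda>i. e (2 * i + k) * e (2 * i + l))) \<longlonglongrightarrow> L"
  shows "(\<lambda>r. tree_mean r (\<lambda>i. bar_residue k r x i * bar_residue l r x i)) \<longlonglongrightarrow> L"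
proof -
  let ?d = "\<lambda>k r. a k - alpha_hat k r x" and ?c = "\<lambda>k r. b k - beta_hat k r x"
  have d: "?d k \<longlonglongrightarrow> 0" and c: "?c k \<longlonglongrightarrow> 0" if "k < 2" for k
    using alpha_hat_tendsto[OF that] beta_hat_tendsto[OF that]
      tendsto_diff[OF tendsto_const[of "a k"]] tendsto_diff[OF tendsto_const[of "b k"]] by fastforce+
  have res: "bar_residue k r x i = e (2 * i + k) + ?d k r * x i + ?c k r" if "1 \<le> i" "k < 2" for i k r
    using daughter[OF that] by (simp add: bar_residue_def algebra_simps)
  have "tree_mean r (\<lambda>i. bar_residue k r x i * bar_residue l r x i) =
      tree_mean r (\<lambda>i. e (2 * i + k) * e (2 * i + l) + ?d l r * (x i * e (2 * i + k)) + ?c l r * e (2 * i + k)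
        + ?d k r * (x i * e (2 * i + l)) + ?c k r * e (2 * i + l) + ?d k r * ?d l r * (x i)\<^sup>2
        + (?d k r * ?c l r + ?c k r * ?d l r) * x i + ?c k r * ?c l r)" for r
  proof (rule tree_mean_cong)
    fix i :: nat assume i: "1 \<le> i"
    show "bar_residue k r x i * bar_residue l r x i =
        e (2 * i + k) * e (2 * i + l) + ?d l r * (x i * e (2 * i + k)) + ?c l r * e (2 * i + k)
        + ?d k r * (x i * e (2 * i + l)) + ?c k r * e (2 * i + l) + ?d k r * ?d l r * (x i)\<^sup>2
        + (?d k r * ?c l r + ?c k r * ?d l r) * x i + ?c k r * ?c l r"
      unfolding res[OF i k] res[OF i l] by (simp add: power2_eq_square algebra_simps)
  qed
  also have "\<dots> r = tree_mean r (\<lambda>i. e (2 * i + k) * e (2 * i + l)) + ?d l r * tree_mean r (\<lambda>i. x i * e (2 * i + k))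
        + ?c l r * tree_mean r (\<lambda>i. e (2 * i + k)) + ?d k r * tree_mean r (\<lambda>i. x i * e (2 * i + l))
        + ?c k r * tree_mean r (\<lambda>i. e (2 * i + l)) + ?d k r * ?d l r * tree_mean r (\<lambda>i. (x i)\<^sup>2)
        + (?d k r * ?c l r + ?c k r * ?d l r) * tree_mean r x + ?c k r * ?c l r" for r
    by (simp only: tree_mean_add tree_mean_cmult tree_mean_const)
  finally have eq: "tree_mean r (\<lambda>i. bar_residue k r x i * bar_residue l r x i) = \<dots> r" for r .
  have "(\<lambda>r. tree_mean r (\<lambda>i. bar_residue k r x i * bar_residue l r x i)) \<longlonglongrightarrow>
      L + 0 * 0 + 0 * 0 + 0 * 0 + 0 * 0 + 0 * 0 * m2 + (0 * 0 + 0 * 0) * m1 + 0 * 0"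
    unfolding eq
    by (intro tendsto_add tendsto_mult lim d c k l mean_tendsto mean_square_tendsto mean_noise mean_x_noise)
  then show ?thesis by simp
qed

lemma sigma2_hat_tendsto: "(\<lambda>r. sigma2_hat r x) \<longlonglongrightarrow> s2"
proof -
  have eq: "sigma2_hat r x = (tree_mean r (\<lambda>i. bar_residue 0 r x i * bar_residue 0 r x i) +
      tree_mean r (\<lambda>i. bar_residue 1 r x i * bar_residue 1 r x i)) / 2" for r
    by (simp add: sigma2_hat_def tree_mean_def power2_eq_square sum.distrib add_divide_distrib)
  have "(\<lambda>r. sigma2_hat r x) \<longlonglongrightarrow> (s2 + s2) / 2"
    unfolding eq using mean_noise_square[of 0] mean_noise_square[of 1]
    by (intro tendsto_intros mean_residue_mult_tendsto) (auto simp: power2_eq_square)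
  then show ?thesis by simp
qed

lemma rho_hat_tendsto: "(\<lambda>r. rho_hat r x) \<longlonglongrightarrow> \<rho>"
proof -
  have eq: "rho_hat r x = tree_mean r (\<lambda>i. bar_residue 0 r x i * bar_residue 1 r x i) / sigma2_hat r x" for r
    by (simp add: rho_hat_def tree_mean_def)
  have "(\<lambda>r. rho_hat r x) \<longlonglongrightarrow> (s2 * \<rho>) / s2"
    unfolding eq using mean_noise_mult s2
    by (intro tendsto_intros mean_residue_mult_tendsto sigma2_hat_tendsto) auto
  then show ?thesis using s2 by simp
qed

lemma mu1_hat_tendsto: "(\<lambda>r. \<mu>1_hat r x) \<longlonglongrightarrow> m1"
  unfolding \<mu>1_hat_def theta_hat_def \<mu>1.simps m1_eq
  by (intro tendsto_intros alpha_hat_tendsto beta_hat_tendsto) (use a_bounds(3) in auto)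

lemma mu2_hat_tendsto: "(\<lambda>r. \<mu>2_hat r x) \<longlonglongrightarrow> m2"
  unfolding \<mu>2_hat_def theta_hat_def \<mu>2.simps m2_def \<theta>_def Let_def
  by (intro tendsto_intros alpha_hat_tendsto beta_hat_tendsto sigma2_hat_tendsto)
    (use a_bounds(3,4) in auto)

text \<open>This is the part of the leading factor with a finite limit; the size of the tree is kept
  apart as the only source of divergence.\<close>

definition "prefactor r = 1 / (2 * sigma2_hat r x * (1 - rho_hat r x))"

lemma prefactor_tendsto: "prefactor \<longlonglongrightarrow> 1 / (2 * s2 * (1 - \<rho>))"
  unfolding prefactor_def[abs_def]
  by (intro tendsto_intros sigma2_hat_tendsto rho_hat_tendsto) (use s2 \<rho> in auto)

lemma var_hat_tendsto: "(\<lambda>r. \<mu>2_hat r x - (\<mu>1_hat r x)\<^sup>2) \<longlonglongrightarrow> var"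
  unfolding var_def by (intro tendsto_intros mu1_hat_tendsto mu2_hat_tendsto)

lemma chi_stat_eq:
  "chi_stat r x = real (card (tree r)) * (prefactor r *
    ((alpha_hat 0 r x - alpha_hat 1 r x)\<^sup>2 * (\<mu>2_hat r x - (\<mu>1_hat r x)\<^sup>2)
      + ((alpha_hat 0 r x - alpha_hat 1 r x) * \<mu>1_hat r x + beta_hat 0 r x - beta_hat 1 r x)\<^sup>2))"
  by (simp add: chi_stat_def prefactor_def)

text \<open>Divided by the size of the tree, the statistic tends to a positive multiple of
  \<open>?L\<close>. Since \<open>var\<close> is positive, \<open>?L\<close> could vanish only if
  the slopes agreed, and then only if the intercepts agreed too.\<close>

theorem chi_stat_at_top:
  assumes "(a 0, b 0) \<noteq> (a 1, b 1)"
  shows "filterlim (\<lambda>r. chi_stat r x) at_top sequentially"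
proof -
  let ?L = "(a 0 - a 1)\<^sup>2 * var + ((a 0 - a 1) * m1 + b 0 - b 1)\<^sup>2"
  have "0 < ?L"
  proof (cases "a 0 = a 1")
    case True
    then show ?thesis using assms by simp
  next
    case False
    then show ?thesis using var_pos by (intro add_pos_nonneg) auto
  qed
  then have pos: "0 < 1 / (2 * s2 * (1 - \<rho>)) * ?L"
    using s2 \<rho> by simp
  have lim: "(\<lambda>r. prefactor r * ((alpha_hat 0 r x - alpha_hat 1 r x)\<^sup>2 * (\<mu>2_hat r x - (\<mu>1_hat r x)\<^sup>2)
      + ((alpha_hat 0 r x - alpha_hat 1 r x) * \<mu>1_hat r x + beta_hat 0 r x - beta_hat 1 r x)\<^sup>2))
      \<longlonglongrightarrow> 1 / (2 * s2 * (1 - \<rho>)) * ?L"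
    by (intro tendsto_mult tendsto_add tendsto_diff tendsto_power prefactor_tendsto var_hat_tendsto
        mu1_hat_tendsto alpha_hat_tendsto beta_hat_tendsto) auto
  show ?thesis
    unfolding chi_stat_eq using filterlim_tendsto_pos_mult_at_top[OF lim pos filterlim_card_tree]
    by (simp add: mult.commute)
qed

text \<open>Under the null hypothesis the difference of the daughters of \<open>i\<close> is the difference of their
  noises, and the statistic is a quadratic form in the empirical means of these differences \<open>\<delta>\<close> and of
  \<open>(x - m1) * \<delta>\<close>, whose coefficients converge.\<close>

theorem chi_stat_null_approx:
  assumes null: "a 0 = a 1" "b 0 = b 1"
  defines "\<delta> \<equiv> \<lambda>i. e (2 * i) - e (2 * i + 1)"
  shows "\<exists>D. D \<longlonglongrightarrow> 0 \<and> (\<forall>r. \<bar>chi_stat r x -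
      card (tree r) / (2 * s2 * (1 - \<rho>)) * ((tree_mean r \<delta>)\<^sup>2 + (tree_mean r (\<lambda>i. (x i - m1) * \<delta> i))\<^sup>2 / var)\<bar>
    \<le> D r * (card (tree r) * ((tree_mean r \<delta>)\<^sup>2 + (tree_mean r (\<lambda>i. (x i - m1) * \<delta> i))\<^sup>2)))"
proof -
  define A B where "A r = tree_mean r \<delta>" and "B r = tree_mean r (\<lambda>i. (x i - m1) * \<delta> i)" for r
  \<comment> \<open>\<open>h\<close> and \<open>f\<close> are the vanishing errors: empirical mean
    against its limit, and plug-in mean against empirical mean. \<open>u\<close> tends to
    \<open>1 / var\<close>, and \<open>w\<close>, built from the plug-in moments, tends to
    \<open>var\<close>.\<close>
  define h where "h r = tree_mean r x - m1" for r
  define u where "u r = 1 / (tree_mean r (\<lambda>i. (x i)\<^sup>2) - (tree_mean r x)\<^sup>2)" for r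
  define f where "f r = \<mu>1_hat r x - tree_mean r x" for r
  define w where "w r = \<mu>2_hat r x - (\<mu>1_hat r x)\<^sup>2" for r
  define K where "K = 1 / (2 * s2 * (1 - \<rho>))"
  have h: "h \<longlonglongrightarrow> 0"
    unfolding h_def[abs_def] using mean_tendsto by (simp add: LIM_zero_iff)
  have f: "f \<longlonglongrightarrow> 0"
    using tendsto_diff[OF mu1_hat_tendsto mean_tendsto] by (simp add: f_def[abs_def])
  have u: "u \<longlonglongrightarrow> 1 / var"
    unfolding u_def[abs_def] by (intro tendsto_intros empirical_var_tendsto) (use var_pos in auto)
  have w: "w \<longlonglongrightarrow> var"
    unfolding w_def[abs_def] by (rule var_hat_tendsto)
  have scale: "prefactor \<longlonglongrightarrow> K"
    unfolding K_def by (rule prefactor_tendsto)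
  have diff_eq: "tree_mean r (\<lambda>i. x (2 * i)) - tree_mean r (\<lambda>i. x (2 * i + 1)) = A r" for r
    using tree_mean_daughter[of 0 r] tree_mean_daughter[of 1 r]
    by (simp add: null A_def \<delta>_def tree_mean_diff)
  have B_eq: "B r = tree_mean r (\<lambda>i. x i * e (2 * i)) - tree_mean r (\<lambda>i. x i * e (2 * i + 1)) -
      (m1 * tree_mean r (\<lambda>i. e (2 * i)) - m1 * tree_mean r (\<lambda>i. e (2 * i + 1)))" for r
    unfolding B_def \<delta>_def left_diff_distrib right_diff_distrib tree_mean_diff tree_mean_cmult by simp
  have mult_diff_eq: "tree_mean r (\<lambda>i. x i * x (2 * i)) - tree_mean r (\<lambda>i. x i * x (2 * i + 1)) = B r + m1 * A r" for r
    using tree_mean_mult_daughter[of 0 r] tree_mean_mult_daughter[of 1 r]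
    by (simp add: null A_def B_eq \<delta>_def tree_mean_diff algebra_simps)
  \<comment> \<open>The difference of the slopes is an empirical covariance with
    \<open>\<delta>\<close>; centering at \<open>m1\<close> instead of the empirical mean costs the
    correction \<open>h r * A r\<close>.\<close>
  have alpha_diff: "alpha_hat 0 r x - alpha_hat 1 r x = u r * (B r - h r * A r)" for r
  proof -
    have "alpha_hat 0 r x - alpha_hat 1 r x =
      u r * ((tree_mean r (\<lambda>i. x i * x (2 * i)) - tree_mean r (\<lambda>i. x i * x (2 * i + 1)))
        - tree_mean r x * (tree_mean r (\<lambda>i. x (2 * i)) - tree_mean r (\<lambda>i. x (2 * i + 1))))"
      by (simp add: alpha_hat_def u_def divide_inverse algebra_simps)
    also have "\<dots> = u r * (B r - h r * A r)"
      unfolding diff_eq mult_diff_eq by (simp add: h_def algebra_simps)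
    finally show ?thesis .
  qed
  have beta_diff: "beta_hat 0 r x - beta_hat 1 r x = A r - tree_mean r x * (alpha_hat 0 r x - alpha_hat 1 r x)" for r
    unfolding diff_eq[symmetric] by (simp add: beta_hat_def algebra_simps)
  \<comment> \<open>The intercepts subtract the empirical mean times the slopes, while the statistic
    adds the plug-in mean times the slopes. The two nearly cancel, and only their difference
    \<open>f r\<close> is left beside \<open>A r\<close>.\<close>
  have shift: "(alpha_hat 0 r x - alpha_hat 1 r x) * \<mu>1_hat r x + beta_hat 0 r x - beta_hat 1 r x =
      A r + u r * (B r - h r * A r) * f r" for r
  proof -
    have "(alpha_hat 0 r x - alpha_hat 1 r x) * \<mu>1_hat r x + beta_hat 0 r x - beta_hat 1 r x =
        (alpha_hat 0 r x - alpha_hat 1 r x) * \<mu>1_hat r x + (A r - tree_mean r x * (alpha_hat 0 r x - alpha_hat 1 r x))"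
      unfolding beta_diff[symmetric] by simp
    also have "\<dots> = A r + u r * (B r - h r * A r) * f r"
      unfolding alpha_diff by (simp add: f_def algebra_simps)
    finally show ?thesis .
  qed
  \<comment> \<open>\<open>c1\<close>, \<open>c2\<close> and \<open>c3\<close> are the coefficients
    of \<open>(B r)\<^sup>2\<close>, \<open>A r * B r\<close> and \<open>(A r)\<^sup>2\<close> in
    the statistic per vertex, minus their limits \<open>K / var\<close>, \<open>0\<close> and
    \<open>K\<close>.\<close>
  define c1 where "c1 r = prefactor r * (w r * (u r)\<^sup>2 + (u r * f r)\<^sup>2) - K / var" for r
  define c2 where "c2 r = 2 * prefactor r * (u r * f r * (1 - u r * h r * f r) - w r * (u r)\<^sup>2 * h r)" for r
  define c3 where "c3 r = prefactor r * (w r * (u r * h r)\<^sup>2 + (1 - u r * h r * f r)\<^sup>2) - K" for r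
  have "c1 \<longlonglongrightarrow> K * (var * (1 / var)\<^sup>2 + (1 / var * 0)\<^sup>2) - K / var"
    unfolding c1_def[abs_def] by (intro tendsto_intros scale u f w)
  then have c1: "c1 \<longlonglongrightarrow> 0"
    using var_pos by (simp add: power2_eq_square)
  have "c2 \<longlonglongrightarrow> 2 * K * (1 / var * 0 * (1 - 1 / var * 0 * 0) - var * (1 / var)\<^sup>2 * 0)"
    unfolding c2_def[abs_def] by (intro tendsto_intros scale u f w h)
  then have c2: "c2 \<longlonglongrightarrow> 0" by simp
  have "c3 \<longlonglongrightarrow> K * (var * (1 / var * 0)\<^sup>2 + (1 - 1 / var * 0 * 0)\<^sup>2) - K"
    unfolding c3_def[abs_def] by (intro tendsto_intros scale u f w h)
  then have c3: "c3 \<longlonglongrightarrow> 0" by simp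
  have key: "chi_stat r x - card (tree r) / (2 * s2 * (1 - \<rho>)) * ((A r)\<^sup>2 + (B r)\<^sup>2 / var) =
      card (tree r) * (c1 r * (B r)\<^sup>2 + c2 r * (A r * B r) + c3 r * (A r)\<^sup>2)" for r
  proof -
    have "chi_stat r x = card (tree r) * (prefactor r * ((u r * (B r - h r * A r))\<^sup>2 * w r
        + (A r + u r * (B r - h r * A r) * f r)\<^sup>2))"
      unfolding chi_stat_eq shift unfolding alpha_diff w_def ..
    moreover have "card (tree r) / (2 * s2 * (1 - \<rho>)) * ((A r)\<^sup>2 + (B r)\<^sup>2 / var) =
        card (tree r) * (K * (A r)\<^sup>2 + K / var * (B r)\<^sup>2)"
      by (simp add: K_def ring_distribs)
    moreover have "prefactor r * ((u r * (B r - h r * A r))\<^sup>2 * w r + (A r + u r * (B r - h r * A r) * f r)\<^sup>2)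
        - (K * (A r)\<^sup>2 + K / var * (B r)\<^sup>2) = c1 r * (B r)\<^sup>2 + c2 r * (A r * B r) + c3 r * (A r)\<^sup>2"
      unfolding c1_def c2_def c3_def power2_eq_square by algebra
    ultimately show ?thesis
      by (simp flip: right_diff_distrib)
  qed
  have bound: "\<bar>c1 r * (B r)\<^sup>2 + c2 r * (A r * B r) + c3 r * (A r)\<^sup>2\<bar>
      \<le> (\<bar>c1 r\<bar> + \<bar>c2 r\<bar> + \<bar>c3 r\<bar>) * ((A r)\<^sup>2 + (B r)\<^sup>2)" for r
  proof -
    have AB: "\<bar>A r * B r\<bar> \<le> (A r)\<^sup>2 + (B r)\<^sup>2"
      using sum_squares_bound[of "\<bar>A r\<bar>" "\<bar>B r\<bar>"] mult_nonneg_nonneg[of "\<bar>A r\<bar>" "\<bar>B r\<bar>"]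
      unfolding abs_mult power2_abs mult.assoc by (smt (verit) abs_ge_zero)
    have "\<bar>c1 r * (B r)\<^sup>2 + c2 r * (A r * B r) + c3 r * (A r)\<^sup>2\<bar>
        \<le> \<bar>c1 r\<bar> * (B r)\<^sup>2 + \<bar>c2 r\<bar> * \<bar>A r * B r\<bar> + \<bar>c3 r\<bar> * (A r)\<^sup>2"
      by (intro order_trans[OF abs_triangle_ineq] add_mono) (auto simp: abs_mult)
    also have "\<dots> \<le> \<bar>c1 r\<bar> * ((A r)\<^sup>2 + (B r)\<^sup>2) + \<bar>c2 r\<bar> * ((A r)\<^sup>2 + (B r)\<^sup>2) + \<bar>c3 r\<bar> * ((A r)\<^sup>2 + (B r)\<^sup>2)"
      using AB by (intro add_mono mult_left_mono) auto
    finally show ?thesis by (simp add: ring_distribs)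
  qed
  have "(\<lambda>r. \<bar>c1 r\<bar> + \<bar>c2 r\<bar> + \<bar>c3 r\<bar>) \<longlonglongrightarrow> \<bar>0\<bar> + \<bar>0\<bar> + \<bar>0\<bar>"
    by (intro tendsto_intros c1 c2 c3)
  moreover have "\<bar>chi_stat r x - card (tree r) / (2 * s2 * (1 - \<rho>)) * ((A r)\<^sup>2 + (B r)\<^sup>2 / var)\<bar>
    \<le> (\<bar>c1 r\<bar> + \<bar>c2 r\<bar> + \<bar>c3 r\<bar>) * (card (tree r) * ((A r)\<^sup>2 + (B r)\<^sup>2))" for r
    unfolding key abs_mult using mult_left_mono[OF bound[of r], of "card (tree r)"] by (simp add: mult_ac)
  ultimately show ?thesis
    unfolding A_def B_def by auto
qed

end

section \<open>The bifurcating autoregressive model\<close>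

text \<open>With \<open>t = \<bar>a\<bar>\<close> and \<open>c = b / (1 - t)\<close>, the left side
  is at most the square of a convex combination of \<open>\<bar>x\<bar>\<close> and
  \<open>\<bar>c\<bar>\<close>. Enlarging the factor from \<open>a\<^sup>2\<close> to
  \<open>\<bar>a\<bar>\<close>, still below 1, absorbs the mixed term.\<close>

lemma convex_square_bound:
  fixes a b x :: real
  assumes "\<bar>a\<bar> < 1"
  shows "(a * x + b)\<^sup>2 \<le> \<bar>a\<bar> * x\<^sup>2 + b\<^sup>2 / (1 - \<bar>a\<bar>)"
proof -
  define t where "t = \<bar>a\<bar>"
  have t: "0 \<le> t" "t < 1" using assms by (auto simp: t_def)
  define c where "c = b / (1 - t)"
  have b: "b = (1 - t) * c" using t by (simp add: c_def)
  have a: "a = t * sgn a" by (simp add: t_def abs_mult_sgn mult.commute)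
  have "(a * x + b)\<^sup>2 \<le> (t * \<bar>x\<bar> + (1 - t) * \<bar>c\<bar>)\<^sup>2"
  proof (rule power2_le_iff_abs_le[THEN iffD2])
    show "0 \<le> t * \<bar>x\<bar> + (1 - t) * \<bar>c\<bar>" using t by simp
    have "\<bar>a * x + b\<bar> \<le> \<bar>a * x\<bar> + \<bar>b\<bar>" by (rule abs_triangle_ineq)
    also have "\<dots> = t * \<bar>x\<bar> + (1 - t) * \<bar>c\<bar>" using t by (simp add: abs_mult b t_def)
    finally show "\<bar>a * x + b\<bar> \<le> t * \<bar>x\<bar> + (1 - t) * \<bar>c\<bar>" .
  qed
  also have "\<dots> \<le> (t * \<bar>x\<bar> + (1 - t) * \<bar>c\<bar>)\<^sup>2 + t * (1 - t) * (\<bar>x\<bar> - \<bar>c\<bar>)\<^sup>2"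
    using t by simp
  also have "\<dots> = t * x\<^sup>2 + (1 - t) * c\<^sup>2"
    unfolding power2_abs[of x, symmetric] power2_abs[of c, symmetric] by algebra
  also have "(1 - t) * c\<^sup>2 = b\<^sup>2 / (1 - t)"
    using t by (simp add: c_def power2_eq_square)
  finally show ?thesis by (simp add: t_def)
qed

section \<open>The filtration of the ancestor and the noises\<close>

context bar_model
begin

text \<open>The ancestor becomes member 0 of a single independent family; a second coordinate 0
  gives it the type of the noise pairs.\<close>

definition innovation :: "nat \<Rightarrow> 'a \<Rightarrow> real \<times> real" where
  "innovation n \<omega> = (if n = 0 then (X 1 \<omega>, 0) else (\<epsilon> (2 * n) \<omega>, \<epsilon> (2 * n + 1) \<omega>))"

lemma noise_pair_measurable: "1 \<le> n \<Longrightarrow> (\<lambda>\<omega>. (\<epsilon> (2 * n) \<omega>, \<epsilon> (2 * n + 1) \<omega>)) \<in> borel_measurable M"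
  using noise_indep unfolding indep_vars_def2 by auto

lemma innovation_measurable[measurable]: "innovation n \<in> borel_measurable M"
proof (cases "n = 0")
  case True
  then show ?thesis
    using ancestor_rv unfolding innovation_def[abs_def] by simp
next
  case False
  then show ?thesis
    using noise_pair_measurable[of n] unfolding innovation_def[abs_def] by simp
qed

text \<open>A finite intersection that involves index 0 splits off the ancestor first. For this the
  remaining events must be read together as one preimage under the whole sequence of noise pairs;
  mutual independence of the pairs then factors them.\<close>

lemma indep_vars_innovation: "indep_vars (\<lambda>_. borel) innovation UNIV"
  unfolding indep_vars_def2
proof (intro conjI ballI indep_setsI)
  fix A :: "nat \<Rightarrow> 'a set" and J :: "nat set"
  let ?P = "\<lambda>\<omega>. \<lambda>n\<in>{1..}. (\<epsilon> (2 * n) \<omega>, \<epsilon> (2 * n + 1) \<omega>)"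
  assume J: "J \<noteq> {}" "finite J" and A: "\<forall>j\<in>J. A j \<in> {innovation j -` B \<inter> space M |B. B \<in> sets borel}"
  then have "\<forall>j\<in>J. \<exists>B. B \<in> sets borel \<and> A j = innovation j -` B \<inter> space M"
    by blast
  then obtain B where B: "\<And>j. j \<in> J \<Longrightarrow> B j \<in> sets borel"
    "\<And>j. j \<in> J \<Longrightarrow> A j = innovation j -` B j \<inter> space M"
    by metis
  have tail: "prob (\<Inter>j\<in>K. A j) = (\<Prod>j\<in>K. prob (A j))" if K: "K \<noteq> {}" "K \<subseteq> J" "0 \<notin> K" for K
  proof (rule indep_setsD)
    show "indep_sets (\<lambda>n. {(\<lambda>\<omega>. (\<epsilon> (2 * n) \<omega>, \<epsilon> (2 * n + 1) \<omega>)) -` A \<inter> space M |A. A \<in> sets borel}) {1..}"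
      using noise_indep unfolding indep_vars_def2 by blast
    show "K \<subseteq> {1..}"
      using K(3) by (auto simp: Suc_le_eq intro!: gr0I)
    show "\<forall>j\<in>K. A j \<in> {(\<lambda>\<omega>. (\<epsilon> (2 * j) \<omega>, \<epsilon> (2 * j + 1) \<omega>)) -` A \<inter> space M |A. A \<in> sets borel}"
    proof
      fix j assume j: "j \<in> K"
      then have "j \<noteq> 0" "j \<in> J" using K by auto
      then have "A j = (\<lambda>\<omega>. (\<epsilon> (2 * j) \<omega>, \<epsilon> (2 * j + 1) \<omega>)) -` B j \<inter> space M"
        using B(2)[of j] by (simp add: innovation_def[abs_def])
      then show "A j \<in> {(\<lambda>\<omega>. (\<epsilon> (2 * j) \<omega>, \<epsilon> (2 * j + 1) \<omega>)) -` A \<inter> space M |A. A \<in> sets borel}"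
        using B(1)[OF \<open>j \<in> J\<close>] by blast
    qed
  qed (use K J in \<open>auto intro: finite_subset\<close>)
  show "prob (\<Inter>j\<in>J. A j) = (\<Prod>j\<in>J. prob (A j))"
  proof (cases "0 \<in> J \<and> J - {0} \<noteq> {}")
    case True
    define K where "K = J - {0}"
    have K: "K \<noteq> {}" "K \<subseteq> J" "0 \<notin> K" "finite K" "J = insert 0 K"
      using True J by (auto simp: K_def)
    have "(\<Inter>j\<in>K. A j) = ?P -` {z \<in> space (PiM {1..} (\<lambda>_. borel)). \<forall>j\<in>K. z j \<in> B j} \<inter> space M"
    proof -
      have "A j = {\<omega> \<in> space M. ?P \<omega> j \<in> B j}" if "j \<in> K" for j
      proof -
        have "j \<noteq> 0" using that K by auto
        then show ?thesis
          using B(2)[of j] that K(2) by (auto simp: innovation_def)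
      qed
      then show ?thesis
        using K(1) by (auto simp: space_PiM)
    qed
    moreover have "{z \<in> space (PiM {1..} (\<lambda>_. borel :: (real \<times> real) measure)). \<forall>j\<in>K. z j \<in> B j} \<in> sets (PiM {1..} (\<lambda>_. borel))"
    proof (rule sets.sets_Collect_finite_All)
      fix j assume "j \<in> K"
      then have [measurable]: "B j \<in> sets borel" and j: "j \<in> {1..}"
        using B(1) K by (auto simp: Suc_le_eq intro!: gr0I)
      have [measurable]: "(\<lambda>z. z j) \<in> measurable (PiM {1..} (\<lambda>_. borel :: (real \<times> real) measure)) borel"
        using measurable_component_singleton[OF j] .
      show "{z \<in> space (PiM {1..} (\<lambda>_. borel :: (real \<times> real) measure)). z j \<in> B j} \<in> sets (PiM {1..} (\<lambda>_. borel))"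
        by measurable
    qed fact
    ultimately have 1: "(\<Inter>j\<in>K. A j) \<in> {?P -` B \<inter> space M | B. B \<in> sets (PiM {1..} (\<lambda>_. borel))}"
      by blast
    have "A 0 = X 1 -` ((\<lambda>x. (x, 0)) -` B 0) \<inter> space M"
      using B(2)[of 0] True by (auto simp: innovation_def)
    moreover have "(\<lambda>x. (x, 0)) -` B 0 \<in> sets (borel :: real measure)"
      using measurable_sets_borel[of "\<lambda>x. (x, 0)" borel "B 0"] B(1)[of 0] True by simp
    ultimately have 2: "A 0 \<in> {X 1 -` A \<inter> space M | A. A \<in> sets borel}"
      by blast
    have "prob (\<Inter>j\<in>J. A j) = prob (A 0 \<inter> (\<Inter>j\<in>K. A j))"
      using K(5) by simp
    also have "\<dots> = prob (A 0) * prob (\<Inter>j\<in>K. A j)"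
      by (rule indep_setD[OF noise_indep_ancestor 2 1])
    also have "\<dots> = (\<Prod>j\<in>J. prob (A j))"
      using tail[OF K(1-3)] K by simp
    finally show ?thesis .
  next
    case False
    then consider "J = {0}" | "0 \<notin> J" using J by auto
    then show ?thesis
      using tail[of J] J by cases auto
  qed
qed (auto simp: innovation_measurable)

text \<open>\<open>past n\<close> carries the ancestor and the noises of the daughters of \<open>1, \<dots>, n - 1\<close>, hence
  \<open>X 1, \<dots>, X n\<close>.\<close>

definition past :: "nat \<Rightarrow> 'a measure" where
  "past n = vimage_algebra (space M) (\<lambda>\<omega>. \<lambda>j\<in>{..<n}. innovation j \<omega>) (PiM {..<n} (\<lambda>_. borel))"

lemma space_past[simp]: "space (past n) = space M"
  by (simp add: past_def)

lemma innovation_past: "j < n \<Longrightarrow> innovation j \<in> borel_measurable (past n)"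
proof -
  assume j: "j < n"
  have "(\<lambda>\<omega>. \<lambda>j\<in>{..<n}. innovation j \<omega>) \<in> measurable (past n) (PiM {..<n} (\<lambda>_. borel))"
    unfolding past_def by (rule measurable_vimage_algebra1) (auto simp: space_PiM)
  from measurable_compose[OF this measurable_component_singleton[of j]] j
  show ?thesis by simp
qed

text \<open>The index sets \<open>{..<n}\<close> and \<open>{n}\<close> are disjoint, so the
  corresponding parts of the independent family are independent. With \<open>g\<close> free, one
  filtration serves the noise of either daughter and their difference.\<close>

lemma adapted_noise_past:
  assumes g[measurable]: "g \<in> borel_measurable borel"
  shows "adapted_noise M past (\<lambda>n \<omega>. g (\<epsilon> (2 * n) \<omega>, \<epsilon> (2 * n + 1) \<omega>))"
proof
  have restr: "(\<lambda>\<omega>. \<lambda>j\<in>{..<n}. innovation j \<omega>) \<in> measurable N (PiM {..<n} (\<lambda>_. borel))"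
    if "\<And>j. j < n \<Longrightarrow> innovation j \<in> borel_measurable N" for N n
    using that by (intro measurable_restrict) auto
  show "subalgebra M (past n)" for n
    unfolding subalgebra_def past_def
    by (intro conjI sets_image_in_sets restr) auto
  show "subalgebra (past n) (past m)" if "m \<le> n" for m n
    unfolding subalgebra_def
  proof
    show "sets (past m) \<subseteq> sets (past n)"
      unfolding past_def[of m]
      by (intro sets_image_in_sets restr innovation_past) (use that in auto)
  qed simp
  fix n :: nat assume n: "1 \<le> n"
  have g_eq: "(\<lambda>\<omega>. g (\<epsilon> (2 * n) \<omega>, \<epsilon> (2 * n + 1) \<omega>)) = (\<lambda>\<omega>. g (innovation n \<omega>))"
    using n by (simp add: innovation_def)
  show "(\<lambda>\<omega>. g (\<epsilon> (2 * n) \<omega>, \<epsilon> (2 * n + 1) \<omega>)) \<in> borel_measurable (past (Suc n))"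
    unfolding g_eq using innovation_past[of n "Suc n"] by measurable
  have "indep_var (PiM {..<n} (\<lambda>_. borel)) (\<lambda>\<omega>. \<lambda>j\<in>{..<n}. innovation j \<omega>)
      (PiM {n} (\<lambda>_. borel)) (\<lambda>\<omega>. \<lambda>j\<in>{n}. innovation j \<omega>)"
    by (rule indep_var_restrict[OF indep_vars_innovation]) auto
  then have ind: "indep_set (sets (past n))
      (sets (vimage_algebra (space M) (\<lambda>\<omega>. \<lambda>j\<in>{n}. innovation j \<omega>) (PiM {n} (\<lambda>_. borel))))"
    unfolding indep_var_eq past_def sets_vimage_algebra by blast
  let ?V = "vimage_algebra (space M) (\<lambda>\<omega>. \<lambda>j\<in>{n}. innovation j \<omega>) (PiM {n} (\<lambda>_. borel))"
  have "(\<lambda>\<omega>. \<lambda>j\<in>{n}. innovation j \<omega>) \<in> measurable ?V (PiM {n} (\<lambda>_. borel))"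
    by (rule measurable_vimage_algebra1) (auto simp: space_PiM)
  from measurable_compose[OF this measurable_component_singleton[of n]]
  have "innovation n \<in> borel_measurable ?V" by simp
  then have "(\<lambda>\<omega>. g (innovation n \<omega>)) \<in> borel_measurable ?V" by measurable
  then have "sets (vimage_algebra (space M) (\<lambda>\<omega>. g (innovation n \<omega>)) borel) \<subseteq> sets ?V"
    by (intro sets_image_in_sets) auto
  with ind show "indep_set (sets (past n))
      (sets (vimage_algebra (space M) (\<lambda>\<omega>. g (\<epsilon> (2 * n) \<omega>, \<epsilon> (2 * n + 1) \<omega>)) borel))"
    unfolding g_eq indep_sets2_eq by blast
qed

text \<open>The combinations in use are \<open>(1, 0)\<close> and \<open>(0, 1)\<close> for the
  daughters and \<open>(1, - 1)\<close> for their difference, where the covariance form has the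
  value \<open>2 * \<sigma>2 * (1 - \<rho>)\<close>.\<close>

lemma gaussian_noise_past:
  assumes uv: "(u, v) \<noteq> (0, 0)" and s: "s\<^sup>2 = u\<^sup>2 * \<sigma>2 + 2 * u * v * (\<sigma>2 * \<rho>) + v\<^sup>2 * \<sigma>2" "0 < s"
  shows "gaussian_noise M past (\<lambda>n \<omega>. u * \<epsilon> (2 * n) \<omega> + v * \<epsilon> (2 * n + 1) \<omega>) s"
proof -
  have "(\<lambda>p. u * fst p + v * snd p) \<in> borel_measurable borel"
    by (intro borel_measurable_continuous_onI continuous_intros)
  then have "adapted_noise M past (\<lambda>n \<omega>. u * \<epsilon> (2 * n) \<omega> + v * \<epsilon> (2 * n + 1) \<omega>)"
    using adapted_noise_past[of "\<lambda>p. u * fst p + v * snd p"] by simp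
  moreover have "distributed M lborel (\<lambda>\<omega>. u * \<epsilon> (2 * n) \<omega> + v * \<epsilon> (2 * n + 1) \<omega>) (normal_density 0 s)"
    if "1 \<le> n" for n
  proof -
    have sd: "sqrt (u\<^sup>2 * \<sigma>2 + 2 * u * v * (\<sigma>2 * \<rho>) + v\<^sup>2 * \<sigma>2) = s"
      using s by (metis less_imp_le real_sqrt_unique)
    show ?thesis
      using noise_gaussian[OF that, unfolded centered_gaussian_pair_def, rule_format, OF uv]
      unfolding sd .
  qed
  ultimately show ?thesis
    using s(2) by (intro gaussian_noise.intro gaussian_noise_axioms.intro) auto
qed

definition \<alpha> :: "nat \<Rightarrow> real" where "\<alpha> k = (if k = 0 then \<alpha>0 else \<alpha>1)"
definition \<beta> :: "nat \<Rightarrow> real" where "\<beta> k = (if k = 0 then \<beta>0 else \<beta>1)"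

lemma daughter:
  assumes "1 \<le> n" "k < 2" "\<omega> \<in> space M"
  shows "X (2 * n + k) \<omega> = \<alpha> k * X n \<omega> + \<beta> k + \<epsilon> (2 * n + k) \<omega>"
proof -
  consider "k = 0" | "k = 1" using assms(2) by linarith
  then show ?thesis
    using assms daughter0[of n \<omega>] daughter1[of n \<omega>] by cases (auto simp: \<alpha>_def \<beta>_def)
qed

lemma gaussian_noise_daughter:
  assumes k: "k < 2"
  shows "gaussian_noise M past (\<lambda>n. \<epsilon> (2 * n + k)) (sqrt \<sigma>2)"
proof -
  consider "k = 0" | "k = 1" using k by linarith
  then show ?thesis
    using sigma2 gaussian_noise_past[of 1 0 "sqrt \<sigma>2"] gaussian_noise_past[of 0 1 "sqrt \<sigma>2"]
    by cases simp_all
qed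

lemma gaussian_noise_diff:
  "gaussian_noise M past (\<lambda>n \<omega>. \<epsilon> (2 * n) \<omega> - \<epsilon> (2 * n + 1) \<omega>) (sqrt (2 * \<sigma>2 * (1 - \<rho>)))"
  using sigma2 rho gaussian_noise_past[of 1 "- 1" "sqrt (2 * \<sigma>2 * (1 - \<rho>))"]
  by (simp add: algebra_simps)

text \<open>Induction along the mother \<open>m = n div 2\<close>: the noise of \<open>n\<close>
  belongs to innovation \<open>m\<close>, which is known in \<open>past (Suc m)\<close>, and
  \<open>Suc m \<le> n\<close> as soon as \<open>n \<ge> 2\<close>.\<close>

lemma X_past: "1 \<le> n \<Longrightarrow> X n \<in> borel_measurable (past n)"
proof (induction n rule: less_induct)
  case (less n)
  show ?case
  proof (cases "n = 1")
    case True
    have "X 1 = (\<lambda>\<omega>. fst (innovation 0 \<omega>))"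
      by (simp add: innovation_def)
    moreover have "(\<lambda>p. fst p) \<in> borel_measurable (borel :: (real \<times> real) measure)"
      by (intro borel_measurable_continuous_onI continuous_intros)
    ultimately show ?thesis
      using measurable_compose[OF innovation_past[of 0 1]] True by simp
  next
    case False
    define m k where "m = n div 2" and "k = n mod 2"
    have n: "n = 2 * m + k" "k < 2" "1 \<le> m" "m < n"
      using False less.prems by (auto simp: m_def k_def)
    interpret N: gaussian_noise M past "\<lambda>n. \<epsilon> (2 * n + k)" "sqrt \<sigma>2"
      using gaussian_noise_daughter[OF n(2)] .
    have "X m \<in> borel_measurable (past n)"
      using N.measurable_past[OF less.IH[OF n(4,3)]] n(4) by simp
    moreover have "\<epsilon> (2 * m + k) \<in> borel_measurable (past n)"
      using N.measurable_past[OF N.noise_adapted[OF n(3)]] n(4) by simp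
    ultimately have "(\<lambda>\<omega>. \<alpha> k * X m \<omega> + \<beta> k + \<epsilon> (2 * m + k) \<omega>) \<in> borel_measurable (past n)"
      by measurable
    then show ?thesis
      using daughter[OF n(3,2)] n(1) by (subst measurable_cong[where g = "\<lambda>\<omega>. \<alpha> k * X m \<omega> + \<beta> k + \<epsilon> (2 * m + k) \<omega>"]) auto
  qed
qed

lemma X_measurable: "1 \<le> n \<Longrightarrow> X n \<in> borel_measurable M"
proof -
  interpret N: gaussian_noise M past "\<lambda>n. \<epsilon> (2 * n + 0)" "sqrt \<sigma>2"
    by (rule gaussian_noise_daughter) simp
  show "1 \<le> n \<Longrightarrow> X n \<in> borel_measurable M"
    using N.measurable_past_M[OF X_past] .
qed

section \<open>Second moments and typical paths\<close>

lemma abs_\<alpha>: "\<bar>\<alpha> k\<bar> < 1"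
  using alpha0 alpha1 by (auto simp: \<alpha>_def)

text \<open>The mother is independent of the noise, so the second moment of a daughter is at most
  \<open>\<bar>\<alpha> k\<bar>\<close> times that of the mother plus \<open>L k\<close>.
  \<open>K\<close> dominates the ancestor and the fixed points
  \<open>L k / (1 - \<bar>\<alpha> k\<bar>)\<close> of both maps, hence is inherited by every
  daughter.\<close>

lemma X_square_bounded:
  assumes X1: "integrable M (\<lambda>\<omega>. (X 1 \<omega>)\<^sup>2)"
  obtains K where "\<And>n. 1 \<le> n \<Longrightarrow> integrable M (\<lambda>\<omega>. (X n \<omega>)\<^sup>2)"
    and "\<And>n. 1 \<le> n \<Longrightarrow> expectation (\<lambda>\<omega>. (X n \<omega>)\<^sup>2) \<le> K"
proof -
  define L where "L k = (\<beta> k)\<^sup>2 / (1 - \<bar>\<alpha> k\<bar>) + \<sigma>2" for k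
  define K where "K = max (expectation (\<lambda>\<omega>. (X 1 \<omega>)\<^sup>2)) (max (L 0 / (1 - \<bar>\<alpha> 0\<bar>)) (L 1 / (1 - \<bar>\<alpha> 1\<bar>)))"
  have L: "\<bar>\<alpha> k\<bar> * K + L k \<le> K" if k: "k < 2" for k
  proof -
    have "L k / (1 - \<bar>\<alpha> k\<bar>) \<le> K"
    proof -
      consider "k = 0" | "k = 1" using k by linarith
      then show ?thesis by cases (auto simp: K_def)
    qed
    then show ?thesis
      using abs_\<alpha>[of k] by (simp add: pos_divide_le_eq algebra_simps)
  qed
  have "1 \<le> n \<longrightarrow> integrable M (\<lambda>\<omega>. (X n \<omega>)\<^sup>2) \<and> expectation (\<lambda>\<omega>. (X n \<omega>)\<^sup>2) \<le> K" for n
  proof (induction n rule: less_induct)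
    case (less n)
    consider "n = 0" | "n = 1" | "2 \<le> n" by linarith
    then show ?case
    proof cases
      case 3
      define m k where "m = n div 2" and "k = n mod 2"
      have n: "n = 2 * m + k" "k < 2" "1 \<le> m" "m < n"
        using 3 by (auto simp: m_def k_def)
      interpret N: gaussian_noise M past "\<lambda>n. \<epsilon> (2 * n + k)" "sqrt \<sigma>2"
        using gaussian_noise_daughter[OF n(2)] .
      interpret NC: centered_noise M past "\<lambda>n. \<epsilon> (2 * n + k)" "(sqrt \<sigma>2)\<^sup>2"
        by (rule N.centered_noise)
      define Y where "Y \<omega> = \<alpha> k * X m \<omega> + \<beta> k" for \<omega>
      let ?e = "\<epsilon> (2 * m + k)"
      have Ym: "Y \<in> borel_measurable (past m)"
        unfolding Y_def[abs_def] using X_past[OF n(3)] by measurable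
      have IH: "integrable M (\<lambda>\<omega>. (X m \<omega>)\<^sup>2)" "expectation (\<lambda>\<omega>. (X m \<omega>)\<^sup>2) \<le> K"
        using less.IH[OF n(4)] n(3) by auto
      have Xint: "integrable M (X m)"
        using square_integrable_imp_integrable[OF X_measurable[OF n(3)] IH(1)] .
      have Yint: "integrable M Y"
        unfolding Y_def[abs_def] using Xint by simp
      have Y2int: "integrable M (\<lambda>\<omega>. (Y \<omega>)\<^sup>2)"
      proof -
        have "(Y \<omega>)\<^sup>2 = (\<alpha> k)\<^sup>2 * (X m \<omega>)\<^sup>2 + 2 * \<alpha> k * \<beta> k * X m \<omega> + (\<beta> k)\<^sup>2" for \<omega>
          by (simp add: Y_def power2_eq_square algebra_simps)
        then show ?thesis using Xint IH(1) by simp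
      qed
      have e_int: "integrable M ?e"
        by (rule NC.noise_integrable[OF n(3)])
      have cross: "integrable M (\<lambda>\<omega>. Y \<omega> * ?e \<omega>)" "expectation (\<lambda>\<omega>. Y \<omega> * ?e \<omega>) = 0"
        using N.integrable_past_mult_noise[OF n(3) Ym Yint, of "\<lambda>x. x"] e_int
          N.expectation_past_mult_noise[OF n(3) Ym Yint, of "\<lambda>x. x"] NC.noise_mean[OF n(3)] by simp_all
      have cong: "integrable M (\<lambda>\<omega>. (X n \<omega>)\<^sup>2) = integrable M (\<lambda>\<omega>. (Y \<omega>)\<^sup>2 + 2 * (Y \<omega> * ?e \<omega>) + (?e \<omega>)\<^sup>2)"
        "expectation (\<lambda>\<omega>. (X n \<omega>)\<^sup>2) = expectation (\<lambda>\<omega>. (Y \<omega>)\<^sup>2 + 2 * (Y \<omega> * ?e \<omega>) + (?e \<omega>)\<^sup>2)"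
        using daughter[OF n(3,2)] n(1)
        by (auto intro!: Bochner_Integration.integrable_cong Bochner_Integration.integral_cong
            simp: Y_def power2_sum)
      have "expectation (\<lambda>\<omega>. (X n \<omega>)\<^sup>2) = expectation (\<lambda>\<omega>. (Y \<omega>)\<^sup>2) + \<sigma>2"
        unfolding cong(2)
        using Y2int cross NC.noise_square_integrable[OF n(3)] NC.noise_variance[OF n(3)] sigma2 by simp
      also have "expectation (\<lambda>\<omega>. (Y \<omega>)\<^sup>2) \<le> expectation (\<lambda>\<omega>. \<bar>\<alpha> k\<bar> * (X m \<omega>)\<^sup>2 + (\<beta> k)\<^sup>2 / (1 - \<bar>\<alpha> k\<bar>))"
        using Y2int IH(1) unfolding Y_def
        by (intro integral_mono convex_square_bound abs_\<alpha>) auto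
      also have "\<dots> = \<bar>\<alpha> k\<bar> * expectation (\<lambda>\<omega>. (X m \<omega>)\<^sup>2) + (\<beta> k)\<^sup>2 / (1 - \<bar>\<alpha> k\<bar>)"
        using IH(1) by (simp add: prob_space)
      also have "\<dots> \<le> \<bar>\<alpha> k\<bar> * K + (\<beta> k)\<^sup>2 / (1 - \<bar>\<alpha> k\<bar>)"
        using IH(2) by (intro add_right_mono mult_left_mono) auto
      finally have "expectation (\<lambda>\<omega>. (X n \<omega>)\<^sup>2) \<le> K"
        using L[OF n(2)] by (simp add: L_def)
      moreover have "integrable M (\<lambda>\<omega>. (X n \<omega>)\<^sup>2)"
        unfolding cong(1) using Y2int cross(1) NC.noise_square_integrable[OF n(3)] by simp
      ultimately show ?thesis by simp
    qed (use X1 in \<open>auto simp: K_def\<close>)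
  qed
  then show ?thesis using that by blast
qed

sublocale param: bar_param \<alpha> \<beta> \<sigma>2
  using abs_\<alpha> sigma2 by unfold_locales

lemma AE_bar_path:
  assumes X1: "integrable M (\<lambda>\<omega>. (X 1 \<omega>)\<^sup>2)"
  shows "AE \<omega> in M. bar_path \<alpha> \<beta> \<sigma>2 \<rho> (\<lambda>n. X n \<omega>) (\<lambda>n. \<epsilon> n \<omega>)"
proof -
  obtain K where K: "\<And>n. 1 \<le> n \<Longrightarrow> integrable M (\<lambda>\<omega>. (X n \<omega>)\<^sup>2)"
    "\<And>n. 1 \<le> n \<Longrightarrow> expectation (\<lambda>\<omega>. (X n \<omega>)\<^sup>2) \<le> K"
    using X_square_bounded[OF X1] by blast
  have noise: "AE \<omega> in M. (\<lambda>r. tree_mean r (\<lambda>i. \<epsilon> (2 * i + k) \<omega>)) \<longlonglongrightarrow> 0 \<and>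
      (\<lambda>r. tree_mean r (\<lambda>i. X i \<omega> * \<epsilon> (2 * i + k) \<omega>)) \<longlonglongrightarrow> 0 \<and>
      (\<lambda>r. tree_mean r (\<lambda>i. (\<epsilon> (2 * i + k) \<omega>)\<^sup>2)) \<longlonglongrightarrow> \<sigma>2"
    if k: "k < 2" for k
  proof -
    interpret N: gaussian_noise M past "\<lambda>n. \<epsilon> (2 * n + k)" "sqrt \<sigma>2"
      using gaussian_noise_daughter[OF k] .
    interpret NC: centered_noise M past "\<lambda>n. \<epsilon> (2 * n + k)" "(sqrt \<sigma>2)\<^sup>2"
      by (rule N.centered_noise)
    have "AE \<omega> in M. (\<lambda>r. tree_mean r (\<lambda>i. 1 * \<epsilon> (2 * i + k) \<omega>)) \<longlonglongrightarrow> 0"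
      by (rule NC.AE_tree_mean_noise[where c = "\<lambda>_ _. 1" and C = 1]) (auto simp: prob_space)
    moreover have "AE \<omega> in M. (\<lambda>r. tree_mean r (\<lambda>i. X i \<omega> * \<epsilon> (2 * i + k) \<omega>)) \<longlonglongrightarrow> 0"
      by (rule NC.AE_tree_mean_noise[OF X_past K])
    ultimately show ?thesis
      using N.AE_tree_mean_square by eventually_elim (use sigma2 in simp)
  qed
  interpret D: gaussian_noise M past "\<lambda>n \<omega>. \<epsilon> (2 * n) \<omega> - \<epsilon> (2 * n + 1) \<omega>" "sqrt (2 * \<sigma>2 * (1 - \<rho>))"
    by (rule gaussian_noise_diff)
  have sd: "(sqrt (2 * \<sigma>2 * (1 - \<rho>)))\<^sup>2 = 2 * \<sigma>2 * (1 - \<rho>)"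
    using sigma2 rho by simp
  have "(1::nat) < 2" by simp
  from noise[OF pos2] noise[OF this] D.AE_tree_mean_square AE_space
  show ?thesis
  proof eventually_elim
    fix \<omega>
    let ?n = "\<lambda>k. (\<lambda>r. tree_mean r (\<lambda>i. \<epsilon> (2 * i + k) \<omega>)) \<longlonglongrightarrow> 0 \<and>
      (\<lambda>r. tree_mean r (\<lambda>i. X i \<omega> * \<epsilon> (2 * i + k) \<omega>)) \<longlonglongrightarrow> 0 \<and>
      (\<lambda>r. tree_mean r (\<lambda>i. (\<epsilon> (2 * i + k) \<omega>)\<^sup>2)) \<longlonglongrightarrow> \<sigma>2"
    assume n: "?n 0" "?n 1" and \<omega>: "\<omega> \<in> space M"
      and d: "(\<lambda>r. tree_mean r (\<lambda>i. (\<epsilon> (2 * i) \<omega> - \<epsilon> (2 * i + 1) \<omega>)\<^sup>2)) \<longlonglongrightarrow> (sqrt (2 * \<sigma>2 * (1 - \<rho>)))\<^sup>2"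
    have n': "?n k" if "k < 2" for k
      using n that by (auto simp: less_2_cases_iff)
    show "bar_path \<alpha> \<beta> \<sigma>2 \<rho> (\<lambda>n. X n \<omega>) (\<lambda>n. \<epsilon> n \<omega>)"
    proof (intro bar_path.intro bar_path_axioms.intro param.bar_param_axioms)
      show "\<rho> < 1" using rho by simp
      show "X (2 * n + k) \<omega> = \<alpha> k * X n \<omega> + \<beta> k + \<epsilon> (2 * n + k) \<omega>" if "1 \<le> n" "k < 2" for n k
        using daughter[OF that \<omega>] .
      \<comment> \<open>Polarization: the product of the two noises is recovered from three squares,
        each the square of a Gaussian noise adapted to \<open>past\<close>, so no separate argument
        for products is required.\<close>
      have "\<epsilon> (2 * i) \<omega> * \<epsilon> (2 * i + 1) \<omega> = 1 / 2 * ((\<epsilon> (2 * i + 0) \<omega>)\<^sup>2 + (\<epsilon> (2 * i + 1) \<omega>)\<^sup>2 -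
          (\<epsilon> (2 * i) \<omega> - \<epsilon> (2 * i + 1) \<omega>)\<^sup>2)" for i
        by (simp add: power2_eq_square algebra_simps)
      then have eq: "tree_mean r (\<lambda>i. \<epsilon> (2 * i) \<omega> * \<epsilon> (2 * i + 1) \<omega>) =
          1 / 2 * (tree_mean r (\<lambda>i. (\<epsilon> (2 * i + 0) \<omega>)\<^sup>2) + tree_mean r (\<lambda>i. (\<epsilon> (2 * i + 1) \<omega>)\<^sup>2) -
            tree_mean r (\<lambda>i. (\<epsilon> (2 * i) \<omega> - \<epsilon> (2 * i + 1) \<omega>)\<^sup>2))" for r
        by (simp only: tree_mean_cmult tree_mean_add tree_mean_diff)
      have "(\<lambda>r. tree_mean r (\<lambda>i. \<epsilon> (2 * i) \<omega> * \<epsilon> (2 * i + 1) \<omega>))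
          \<longlonglongrightarrow> 1 / 2 * (\<sigma>2 + \<sigma>2 - 2 * \<sigma>2 * (1 - \<rho>))"
        unfolding eq using n d unfolding sd by (intro tendsto_intros) auto
      then show "(\<lambda>r. tree_mean r (\<lambda>i. \<epsilon> (2 * i) \<omega> * \<epsilon> (2 * i + 1) \<omega>)) \<longlonglongrightarrow> \<sigma>2 * \<rho>"
        by (simp add: algebra_simps)
    qed (use n' in auto)
  qed
qed

section \<open>The statistic under the two hypotheses\<close>

lemma chi_stat_measurable: "(\<lambda>\<omega>. chi_stat r (\<lambda>n. X n \<omega>)) \<in> borel_measurable M"
proof -
  have [measurable]: "(\<lambda>\<omega>. tree_mean r (\<lambda>i. X i \<omega>)) \<in> borel_measurable M"
    "(\<lambda>\<omega>. tree_mean r (\<lambda>i. X (2 * i + k) \<omega>)) \<in> borel_measurable M"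
    "(\<lambda>\<omega>. tree_mean r (\<lambda>i. X i \<omega> * X (2 * i + k) \<omega>)) \<in> borel_measurable M"
    "(\<lambda>\<omega>. tree_mean r (\<lambda>i. (X i \<omega>)\<^sup>2)) \<in> borel_measurable M" for k
    by (intro tree_mean_measurable borel_measurable_times borel_measurable_power X_measurable; simp)+
  have ab[measurable]: "(\<lambda>\<omega>. alpha_hat k r (\<lambda>n. X n \<omega>)) \<in> borel_measurable M"
    "(\<lambda>\<omega>. beta_hat k r (\<lambda>n. X n \<omega>)) \<in> borel_measurable M" for k
    unfolding alpha_hat_def beta_hat_def by measurable
  have [measurable]: "(\<lambda>\<omega>. bar_residue k r (\<lambda>n. X n \<omega>) i) \<in> borel_measurable M" if "i \<in> tree r" for k i
    unfolding bar_residue_def using that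
    by (intro borel_measurable_diff borel_measurable_times ab X_measurable) (auto simp: tree_def)
  have [measurable]: "(\<lambda>\<omega>. sigma2_hat r (\<lambda>n. X n \<omega>)) \<in> borel_measurable M"
    unfolding sigma2_hat_def by measurable
  have [measurable]: "(\<lambda>\<omega>. rho_hat r (\<lambda>n. X n \<omega>)) \<in> borel_measurable M"
    unfolding rho_hat_def by measurable
  show ?thesis
    unfolding chi_stat_def \<mu>1_hat_def \<mu>2_hat_def theta_hat_def \<mu>1.simps \<mu>2.simps Let_def
    by measurable
qed

abbreviation "\<delta> \<equiv> (\<lambda>i \<omega>. \<epsilon> (2 * i) \<omega> - \<epsilon> (2 * i + 1) \<omega>)"

text \<open>\<open>P r 0\<close> and \<open>P r 1\<close> are the asymptotically standard normal and independent
  normalisations of the empirical means of \<open>\<delta>\<close> and \<open>(X - param.m1) * \<delta>\<close>.\<close>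

definition P :: "nat \<Rightarrow> nat \<Rightarrow> 'a \<Rightarrow> real" where
  "P r j \<omega> = sqrt (card (tree r)) / sqrt (2 * \<sigma>2 * (1 - \<rho>)) *
    tree_mean r (\<lambda>i. (if j = 0 then 1 else (X i \<omega> - param.m1) / sqrt param.var) * \<delta> i \<omega>)"

text \<open>This tree mean is the conditional variance of \<open>z0 * P r 0 + z1 * P r 1\<close>.
  The standardised \<open>X\<close> has empirical mean tending to 0 and empirical second moment
  tending to 1, so the mixed term disappears and the limiting covariance is the identity.\<close>

lemma tree_mean_affine_square_tendsto:
  assumes "bar_path \<alpha> \<beta> \<sigma>2 \<rho> (\<lambda>n. X n \<omega>) (\<lambda>n. \<epsilon> n \<omega>)"
  shows "(\<lambda>r. tree_mean r (\<lambda>i. (z0 + z1 * ((X i \<omega> - param.m1) / sqrt param.var))\<^sup>2)) \<longlonglongrightarrow> z0\<^sup>2 + z1\<^sup>2"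
proof -
  interpret path: bar_path \<alpha> \<beta> \<sigma>2 \<rho> "\<lambda>n. X n \<omega>" "\<lambda>n. \<epsilon> n \<omega>" by fact
  define p q where "p = z1 / sqrt param.var" and "q = z0 - z1 / sqrt param.var * param.m1"
  have affine: "z0 + z1 * ((X i \<omega> - param.m1) / sqrt param.var) = p * X i \<omega> + q" for i
    by (simp add: p_def q_def diff_divide_distrib right_diff_distrib)
  have "(p * X i \<omega> + q)\<^sup>2 = p\<^sup>2 * (X i \<omega>)\<^sup>2 + 2 * p * q * X i \<omega> + q\<^sup>2" for i
    by (simp add: power2_eq_square algebra_simps)
  then have "tree_mean r (\<lambda>i. (p * X i \<omega> + q)\<^sup>2) =
      p\<^sup>2 * tree_mean r (\<lambda>i. (X i \<omega>)\<^sup>2) + 2 * p * q * tree_mean r (\<lambda>i. X i \<omega>) + q\<^sup>2" for r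
    by (simp only: tree_mean_add tree_mean_cmult tree_mean_const)
  then have "(\<lambda>r. tree_mean r (\<lambda>i. (p * X i \<omega> + q)\<^sup>2)) \<longlonglongrightarrow> p\<^sup>2 * param.m2 + 2 * p * q * param.m1 + q\<^sup>2"
    by (auto intro!: tendsto_intros path.mean_tendsto path.mean_square_tendsto)
  also have "p\<^sup>2 * param.m2 + 2 * p * q * param.m1 + q\<^sup>2 = p\<^sup>2 * param.var + (p * param.m1 + q)\<^sup>2"
    by (simp add: param.var_def power2_eq_square algebra_simps)
  also have "\<dots> = z0\<^sup>2 + z1\<^sup>2"
    using param.var_pos by (simp add: p_def q_def power_divide)
  finally show ?thesis unfolding affine .
qed

lemma char_P_tendsto:
  assumes X1: "integrable M (\<lambda>\<omega>. (X 1 \<omega>)\<^sup>2)"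
  shows "(\<lambda>r. \<integral>\<omega>. iexp (\<Sum>j<2. z j * P r j \<omega>) \<partial>M) \<longlonglongrightarrow> of_real (exp (- (\<Sum>j<2. (z j)\<^sup>2) / 2))"
proof -
  define s where "s = sqrt (2 * \<sigma>2 * (1 - \<rho>))"
  interpret D: gaussian_noise M past \<delta> s
    unfolding s_def by (rule gaussian_noise_diff)
  define N where "N r = real (card (tree r))" for r
  have N: "0 < N r" for r
    unfolding N_def by (rule card_tree_pos)
  define g where "g i \<omega> = z 0 + z 1 * ((X i \<omega> - param.m1) / sqrt param.var)" for i \<omega>
  \<comment> \<open>The divisor \<open>s\<close> cancels the standard deviation of the noise, and
    \<open>sqrt (N r)\<close> turns the sum of the squares
    \<open>(c r i \<omega> * s)\<^sup>2\<close> into a tree mean.\<close>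
  define c where "c r i \<omega> = 1 / (sqrt (N r) * s) * g i \<omega>" for r i \<omega>
  have tree: "tree r = {1..2 ^ (r + 1) - 1}" for r
    by (simp add: tree_def)
  have sum_eq: "(\<Sum>j<2. z j * P r j \<omega>) = (\<Sum>i=1..2 ^ (r + 1) - 1. c r i \<omega> * \<delta> i \<omega>)" for r \<omega>
  proof -
    have "sqrt (N r) / N r = 1 / sqrt (N r)"
      using N[of r] by (simp add: real_div_sqrt field_simps)
    then have sq: "sqrt (N r) / s * (y / N r) = 1 / (sqrt (N r) * s) * y" for y
      by (metis (no_types, opaque_lifting) divide_divide_eq_left mult.commute times_divide_eq_left times_divide_eq_right mult_1)
    have "(\<Sum>j<2. z j * P r j \<omega>) = sqrt (N r) / s *
        tree_mean r (\<lambda>i. z 0 * (1 * \<delta> i \<omega>) + z 1 * ((X i \<omega> - param.m1) / sqrt param.var * \<delta> i \<omega>))"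
      unfolding tree_mean_add tree_mean_cmult
      by (simp add: P_def N_def s_def numeral_2_eq_2 distrib_left mult.left_commute)
    also have "\<dots> = sqrt (N r) / s * ((\<Sum>i\<in>tree r. g i \<omega> * \<delta> i \<omega>) / N r)"
      by (simp add: tree_mean_def N_def g_def distrib_right mult.assoc)
    also have "\<dots> = (\<Sum>i\<in>tree r. c r i \<omega> * \<delta> i \<omega>)"
      unfolding sq by (simp add: c_def sum_distrib_left mult.assoc)
    finally show ?thesis unfolding tree .
  qed
  have "(\<lambda>r. \<integral>\<omega>. iexp (\<Sum>i=1..2 ^ (r + 1) - 1. c r i \<omega> * \<delta> i \<omega>) \<partial>M)
      \<longlonglongrightarrow> of_real (exp (- ((z 0)\<^sup>2 + (z 1)\<^sup>2) / 2))"
  proof (rule D.char_noise_sum_tendsto)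
    show "c r k \<in> borel_measurable (past k)" if "1 \<le> k" for r k
      using X_past[OF that] unfolding c_def[abs_def] g_def[abs_def] by measurable
    show "AE \<omega> in M. (\<lambda>r. \<Sum>k=1..2 ^ (r + 1) - 1. (c r k \<omega> * s)\<^sup>2) \<longlonglongrightarrow> (z 0)\<^sup>2 + (z 1)\<^sup>2"
      using AE_bar_path[OF X1]
    proof eventually_elim
      fix \<omega> assume "bar_path \<alpha> \<beta> \<sigma>2 \<rho> (\<lambda>n. X n \<omega>) (\<lambda>n. \<epsilon> n \<omega>)"
      from tree_mean_affine_square_tendsto[OF this, of "z 0" "z 1"]
      have "(\<lambda>r. tree_mean r (\<lambda>i. (g i \<omega>)\<^sup>2)) \<longlonglongrightarrow> (z 0)\<^sup>2 + (z 1)\<^sup>2"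
        unfolding g_def .
      moreover have "(\<Sum>k=1..2 ^ (r + 1) - 1. (c r k \<omega> * s)\<^sup>2) = tree_mean r (\<lambda>i. (g i \<omega>)\<^sup>2)" for r
      proof -
        have "(c r k \<omega> * s)\<^sup>2 = (g k \<omega>)\<^sup>2 / N r" for k
          using N[of r] D.s_pos by (simp add: c_def power_mult_distrib power_divide)
        then show ?thesis
          by (simp only: tree[symmetric] tree_mean_def N_def sum_divide_distrib)
      qed
      ultimately show "(\<lambda>r. \<Sum>k=1..2 ^ (r + 1) - 1. (c r k \<omega> * s)\<^sup>2) \<longlonglongrightarrow> (z 0)\<^sup>2 + (z 1)\<^sup>2"
        by simp
    qed
  qed
  then show ?thesis
    unfolding sum_eq by (simp add: numeral_2_eq_2)
qed

text \<open>It supplies the variable that is bounded in mean for \<open>weak_conv_m_perturb\<close>: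
  the size of the tree times a squared mean is a squared partial sum divided by the number of its
  orthogonal terms.\<close>

lemma tree_mean_\<delta>_bounded:
  assumes c: "\<And>k. 1 \<le> k \<Longrightarrow> c k \<in> borel_measurable (past k)"
    "\<And>k. 1 \<le> k \<Longrightarrow> integrable M (\<lambda>\<omega>. (c k \<omega>)\<^sup>2)" "\<And>k. 1 \<le> k \<Longrightarrow> expectation (\<lambda>\<omega>. (c k \<omega>)\<^sup>2) \<le> C"
  shows "integrable M (\<lambda>\<omega>. card (tree r) * (tree_mean r (\<lambda>i. c i \<omega> * \<delta> i \<omega>))\<^sup>2)"
    and "expectation (\<lambda>\<omega>. card (tree r) * (tree_mean r (\<lambda>i. c i \<omega> * \<delta> i \<omega>))\<^sup>2) \<le> C * (2 * \<sigma>2 * (1 - \<rho>))"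
proof -
  interpret D: gaussian_noise M past \<delta> "sqrt (2 * \<sigma>2 * (1 - \<rho>))"
    by (rule gaussian_noise_diff)
  have sd: "(sqrt (2 * \<sigma>2 * (1 - \<rho>)))\<^sup>2 = 2 * \<sigma>2 * (1 - \<rho>)"
    using sigma2 rho by simp
  interpret DC: centered_noise M past \<delta> "2 * \<sigma>2 * (1 - \<rho>)"
    using D.centered_noise unfolding sd .
  define n where "n = card (tree r)"
  have tree: "tree r = {1..n}"
    by (simp add: n_def tree_def)
  have n: "0 < n"
    using card_tree_pos[of r] by (simp add: n_def)
  have eq: "card (tree r) * (tree_mean r (\<lambda>i. c i \<omega> * \<delta> i \<omega>))\<^sup>2 = (\<Sum>i=1..n. c i \<omega> * \<delta> i \<omega>)\<^sup>2 / n" for \<omega>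
    using n by (simp add: tree_mean_def tree power_divide power2_eq_square)
  show "integrable M (\<lambda>\<omega>. card (tree r) * (tree_mean r (\<lambda>i. c i \<omega> * \<delta> i \<omega>))\<^sup>2)"
    unfolding eq using DC.integrable_sum_noise_square[OF c, of n] by simp
  have "expectation (\<lambda>\<omega>. (\<Sum>i=1..n. c i \<omega> * \<delta> i \<omega>)\<^sup>2) / n \<le> (n * C * (2 * \<sigma>2 * (1 - \<rho>))) / n"
    using DC.expectation_sum_noise_square[OF c, of n] by (intro divide_right_mono) auto
  then show "expectation (\<lambda>\<omega>. card (tree r) * (tree_mean r (\<lambda>i. c i \<omega> * \<delta> i \<omega>))\<^sup>2) \<le> C * (2 * \<sigma>2 * (1 - \<rho>))"
    unfolding eq using n by simp
qed

theorem chi_stat_null: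
  assumes X1: "integrable M (\<lambda>\<omega>. (X 1 \<omega>)\<^sup>2)" and null: "\<alpha>0 = \<alpha>1" "\<beta>0 = \<beta>1"
  shows "weak_conv_m (\<lambda>r. distr M borel (\<lambda>\<omega>. chi_stat r (\<lambda>n. X n \<omega>))) (chi_square 2)"
proof -
  interpret D: gaussian_noise M past \<delta> "sqrt (2 * \<sigma>2 * (1 - \<rho>))"
    by (rule gaussian_noise_diff)
  obtain K where K: "\<And>n. 1 \<le> n \<Longrightarrow> integrable M (\<lambda>\<omega>. (X n \<omega>)\<^sup>2)"
    "\<And>n. 1 \<le> n \<Longrightarrow> expectation (\<lambda>\<omega>. (X n \<omega>)\<^sup>2) \<le> K"
    using X_square_bounded[OF X1] by blast
  define c1 where "c1 k \<omega> = X k \<omega> - param.m1" for k \<omega>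
  have c1m: "c1 k \<in> borel_measurable (past k)" if "1 \<le> k" for k
    using X_past[OF that] unfolding c1_def[abs_def] by measurable
  \<comment> \<open>The right side minus the left side is
    \<open>(X k \<omega> + param.m1)\<^sup>2\<close>.\<close>
  have c1_bound: "(c1 k \<omega>)\<^sup>2 \<le> 2 * (X k \<omega>)\<^sup>2 + 2 * param.m1\<^sup>2" for k \<omega>
    using zero_le_power2[of "X k \<omega> + param.m1"] by (simp add: c1_def power2_eq_square algebra_simps)
  have c1int: "integrable M (\<lambda>\<omega>. (c1 k \<omega>)\<^sup>2)" if "1 \<le> k" for k
  proof (rule Bochner_Integration.integrable_bound)
    show "integrable M (\<lambda>\<omega>. 2 * (X k \<omega>)\<^sup>2 + 2 * param.m1\<^sup>2)"
      using K(1)[OF that] by simp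
    show "(\<lambda>\<omega>. (c1 k \<omega>)\<^sup>2) \<in> borel_measurable M"
      using D.measurable_past_M[OF c1m[OF that]] by measurable
  qed (use c1_bound in auto)
  have c1E: "expectation (\<lambda>\<omega>. (c1 k \<omega>)\<^sup>2) \<le> 2 * K + 2 * param.m1\<^sup>2" if "1 \<le> k" for k
  proof -
    have "expectation (\<lambda>\<omega>. (c1 k \<omega>)\<^sup>2) \<le> expectation (\<lambda>\<omega>. 2 * (X k \<omega>)\<^sup>2 + 2 * param.m1\<^sup>2)"
      using c1int[OF that] K(1)[OF that] by (intro integral_mono c1_bound) auto
    also have "\<dots> \<le> 2 * K + 2 * param.m1\<^sup>2"
      using K[OF that] by (simp add: prob_space)
    finally show ?thesis .
  qed
  have A_int: "integrable M (\<lambda>\<omega>. card (tree r) * (tree_mean r (\<lambda>i. \<delta> i \<omega>))\<^sup>2)"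
    and A_E: "expectation (\<lambda>\<omega>. card (tree r) * (tree_mean r (\<lambda>i. \<delta> i \<omega>))\<^sup>2) \<le> 1 * (2 * \<sigma>2 * (1 - \<rho>))" for r
    using tree_mean_\<delta>_bounded[of "\<lambda>_ _. 1" 1 r] by (simp_all add: prob_space)
  note B_int = tree_mean_\<delta>_bounded(1)[of c1, OF c1m c1int c1E]
    and B_E = tree_mean_\<delta>_bounded(2)[of c1, OF c1m c1int c1E]
  have Pm: "P r j \<in> borel_measurable M" for r j
  proof -
    have "(\<lambda>\<omega>. (if j = 0 then 1 else (X i \<omega> - param.m1) / sqrt param.var) * \<delta> i \<omega>) \<in> borel_measurable M" if "1 \<le> i" for i
      using X_measurable[OF that] D.noise_measurable[OF that] by (cases "j = 0") simp_all
    from tree_mean_measurable[OF this] show ?thesis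
      unfolding P_def[abs_def] by (rule borel_measurable_times[OF borel_measurable_const])
  qed
  show ?thesis
  proof (rule weak_conv_m_perturb)
    show "weak_conv_m (\<lambda>r. distr M borel (\<lambda>\<omega>. \<Sum>j<2. (P r j \<omega>)\<^sup>2)) (chi_square 2)"
      by (rule weak_conv_m_chi_square[OF prob_space_axioms Pm char_P_tendsto[OF X1]])
    show "AE \<omega> in M. \<exists>D. D \<longlonglongrightarrow> 0 \<and> (\<forall>r. \<bar>chi_stat r (\<lambda>n. X n \<omega>) - (\<Sum>j<2. (P r j \<omega>)\<^sup>2)\<bar>
        \<le> D r * (card (tree r) * (tree_mean r (\<lambda>i. \<delta> i \<omega>))\<^sup>2 + card (tree r) * (tree_mean r (\<lambda>i. c1 i \<omega> * \<delta> i \<omega>))\<^sup>2))"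
      using AE_bar_path[OF X1]
    proof eventually_elim
      fix \<omega> assume "bar_path \<alpha> \<beta> \<sigma>2 \<rho> (\<lambda>n. X n \<omega>) (\<lambda>n. \<epsilon> n \<omega>)"
      then interpret path: bar_path \<alpha> \<beta> \<sigma>2 \<rho> "\<lambda>n. X n \<omega>" "\<lambda>n. \<epsilon> n \<omega>" .
      \<comment> \<open>The squared norm of the two normalised sums is exactly the quadratic form
        with the limiting coefficients, the one from which \<open>chi_stat_null_approx\<close>
        measures the distance of the statistic.\<close>
      have Q: "(\<Sum>j<2. (P r j \<omega>)\<^sup>2) = card (tree r) / (2 * \<sigma>2 * (1 - \<rho>)) *
          ((tree_mean r (\<lambda>i. \<delta> i \<omega>))\<^sup>2 + (tree_mean r (\<lambda>i. (X i \<omega> - param.m1) * \<delta> i \<omega>))\<^sup>2 / param.var)" for r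
      proof -
        have "tree_mean r (\<lambda>i. (X i \<omega> - param.m1) / sqrt param.var * \<delta> i \<omega>) =
            1 / sqrt param.var * tree_mean r (\<lambda>i. (X i \<omega> - param.m1) * \<delta> i \<omega>)"
          unfolding tree_mean_cmult[symmetric] by simp
        then have "P r 1 \<omega> = sqrt (card (tree r)) / sqrt (2 * \<sigma>2 * (1 - \<rho>)) *
            (1 / sqrt param.var * tree_mean r (\<lambda>i. (X i \<omega> - param.m1) * \<delta> i \<omega>))"
          by (simp add: P_def)
        moreover have "P r 0 \<omega> = sqrt (card (tree r)) / sqrt (2 * \<sigma>2 * (1 - \<rho>)) * tree_mean r (\<lambda>i. \<delta> i \<omega>)"
          by (simp add: P_def)
        moreover have "(\<Sum>j<2. (P r j \<omega>)\<^sup>2) = (P r 0 \<omega>)\<^sup>2 + (P r 1 \<omega>)\<^sup>2"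
          by (simp add: numeral_2_eq_2)
        ultimately show ?thesis
          using sigma2 rho param.var_pos
          by (simp add: power_mult_distrib power_divide distrib_left)
      qed
      have "\<alpha> 0 = \<alpha> 1" "\<beta> 0 = \<beta> 1"
        unfolding \<alpha>_def \<beta>_def using null by simp_all
      from path.chi_stat_null_approx[OF this]
      show "\<exists>D. D \<longlonglongrightarrow> 0 \<and> (\<forall>r. \<bar>chi_stat r (\<lambda>n. X n \<omega>) - (\<Sum>j<2. (P r j \<omega>)\<^sup>2)\<bar>
        \<le> D r * (card (tree r) * (tree_mean r (\<lambda>i. \<delta> i \<omega>))\<^sup>2 + card (tree r) * (tree_mean r (\<lambda>i. c1 i \<omega> * \<delta> i \<omega>))\<^sup>2))"
        unfolding Q c1_def distrib_left .
    qed
    show "expectation (\<lambda>\<omega>. card (tree r) * (tree_mean r (\<lambda>i. \<delta> i \<omega>))\<^sup>2 + card (tree r) * (tree_mean r (\<lambda>i. c1 i \<omega> * \<delta> i \<omega>))\<^sup>2)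
        \<le> 1 * (2 * \<sigma>2 * (1 - \<rho>)) + (2 * K + 2 * param.m1\<^sup>2) * (2 * \<sigma>2 * (1 - \<rho>))" for r
      using add_mono[OF A_E[of r] B_E[of r]] A_int[of r] B_int[of r] by simp
    show "integrable M (\<lambda>\<omega>. card (tree r) * (tree_mean r (\<lambda>i. \<delta> i \<omega>))\<^sup>2 +
        card (tree r) * (tree_mean r (\<lambda>i. c1 i \<omega> * \<delta> i \<omega>))\<^sup>2)" for r
      using A_int[of r] B_int[of r] by (rule Bochner_Integration.integrable_add)
  qed (use Pm chi_stat_measurable real_distribution_chi_square in \<open>auto intro: prob_space_axioms\<close>)
qed

theorem chi_stat_alternative:
  assumes X1: "integrable M (\<lambda>\<omega>. (X 1 \<omega>)\<^sup>2)" and alt: "(\<alpha>0, \<beta>0) \<noteq> (\<alpha>1, \<beta>1)"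
  shows "AE \<omega> in M. filterlim (\<lambda>r. chi_stat r (\<lambda>n. X n \<omega>)) at_top sequentially"
  using AE_bar_path[OF X1]
proof eventually_elim
  fix \<omega> assume "bar_path \<alpha> \<beta> \<sigma>2 \<rho> (\<lambda>n. X n \<omega>) (\<lambda>n. \<epsilon> n \<omega>)"
  then interpret path: bar_path \<alpha> \<beta> \<sigma>2 \<rho> "\<lambda>n. X n \<omega>" "\<lambda>n. \<epsilon> n \<omega>" .
  show "filterlim (\<lambda>r. chi_stat r (\<lambda>n. X n \<omega>)) at_top sequentially"
    by (rule path.chi_stat_at_top) (use alt in \<open>simp add: \<alpha>_def \<beta>_def\<close>)
qed

end

theorem proposition35:
  fixes M :: "'a measure" and \<nu> :: "real measure"
    and \<alpha>0 \<beta>0 \<alpha>1 \<beta>1 \<sigma>2 \<rho> :: real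
    and X \<epsilon> :: "nat \<Rightarrow> 'a \<Rightarrow> real"
  assumes "bar_model M \<nu> \<alpha>0 \<beta>0 \<alpha>1 \<beta>1 \<sigma>2 \<rho> X \<epsilon>"
    and "\<And>k::nat. integrable \<nu> (\<lambda>x. \<bar>x\<bar> ^ k)"
  shows "((\<alpha>0, \<beta>0) = (\<alpha>1, \<beta>1) \<longrightarrow>
           weak_conv_m (\<lambda>r. distr M borel (\<lambda>\<omega>. chi_stat r (\<lambda>n. X n \<omega>))) (chi_square 2)) \<and>
         ((\<alpha>0, \<beta>0) \<noteq> (\<alpha>1, \<beta>1) \<longrightarrow>
           (AE \<omega> in M. filterlim (\<lambda>r. chi_stat r (\<lambda>n. X n \<omega>)) at_top sequentially))"
proof -
  interpret bar_model M \<nu> \<alpha>0 \<beta>0 \<alpha>1 \<beta>1 \<sigma>2 \<rho> X \<epsilon> by fact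
  have "integrable (distr M borel (X 1)) (\<lambda>x. x\<^sup>2)"
    using assms(2)[of 2] unfolding ancestor_law by simp
  then have "integrable M (\<lambda>\<omega>. (X 1 \<omega>)\<^sup>2)"
    using ancestor_rv by (simp add: integrable_distr_eq)
  then show ?thesis
    using chi_stat_null chi_stat_alternative by auto
qed

end
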